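(* Let $r,k$ be integers with $1\le r\le k$. For positive integers $b$ define $\boldsymbol\Lambda_{b,k}=\sum_{j=1}^k\mathbf K_{b^j,b^{k-j}}\in\mathcal M_{b^k\times b^k}$ and $$\boldsymbol\Gamma_{b,k,r}=\prod_{j=0}^{r-1}(\boldsymbol\Lambda_{b,k-j}\otimes\mathbf I_{b^j})=\boldsymbol\Lambda_{b,k}(\boldsymbol\Lambda_{b,k-1}\otimes\mathbf I_b)\cdots(\boldsymbol\Lambda_{b,k-r+1}\otimes\mathbf I_{b^{r-1}})\in\mathcal M_{b^k\times b^k}.$$ (i) Let $\boldsymbol f\colon\mathcal M_{c\times d}\to\mathbb R^{b^k}$ be the $k$-fold Kronecker product $\boldsymbol f(\mathbf X)=(\operatorname{vec}\mathbf X)^{\otimes k}$, where $b=cd$. Then the $r$th derivative of $(\operatorname{vec}\mathbf X)^{\otimes k}$ is $$\mathsf D^{\otimes r}\{(\operatorname{vec}\mathbf X)^{\otimes k}\}=(\boldsymbol\Gamma_{b,k,r}\otimes\boldsymbol{\mathcal S}_{b,r})\big\{(\operatorname{vec}\mathbf X)^{\otimes(k-r)}\otimes\operatorname{vec}\mathbf I_{b^r}\big\}\in\mathbb R^{b^{k+r}}.$$ (ii) Let $\boldsymbol f\colon\mathbb R^d\to\mathbb R^{d^k}$ be the $k$-fold Kronecker product $\boldsymbol f(\boldsymbol x)=\boldsymbol x^{\otimes k}$. Then the $r$th derivative of $\boldsymbol x^{\otimes k}$ is $$\mathsf D^{\otimes r}(\boldsymbol x^{\otimes k})=(\boldsymbol\Gamma_{d,k,r}\otimes\boldsymbol{\mathcal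 S}_{d,r})\big(\boldsymbol x^{\otimes(k-r)}\otimes\operatorname{vec}\mathbf I_{d^r}\big)\in\mathbb R^{d^{k+r}}.$$ (iii) Let $\mathbf F\colon\mathcal M_{d\times d}\to\mathcal M_{d\times d}$ be the $k$th matrix power $\mathbf F(\mathbf X)=\mathbf X^k$. Then the $r$th derivative of $\mathbf X^k$ is $$\mathsf D^{\otimes r}\operatorname{vec}(\mathbf X^k)=(\boldsymbol\Upsilon_{d,k,r}\otimes\boldsymbol{\mathcal S}_{d^2,r})\big\{(\operatorname{vec}\mathbf X)^{\otimes(k-r)}\otimes\operatorname{vec}\mathbf I_{d^{2r}}\big\}\in\mathbb R^{d^{2r+2}},$$ where $\boldsymbol\Upsilon_{d,k,r}=\{\mathbf I_d\otimes(\operatorname{vec}^\top\mathbf I_d)^{\otimes(k-1)}\otimes\mathbf I_d\}\boldsymbol\Gamma_{d^2,k,r}\in\mathcal M_{d^2\times d^{2k}}$. (iv) Let $f\colon\mathcal M_{d\times d}\to\mathbb R$ be the trace of the $k$th matrix power, $f(\mathbf X)=\operatorname{tr}\mathbf X^k$. Then, with $\boldsymbol\Upsilon_{d,k,r}$ as defined in (iii), the $r$th derivative of $\operatorname{tr}\mathbf X^k$ is $$\mathsf D^{\otimes r}\operatorname{tr}(\mathbf X^k)=\big[\{(\operatorname{vec}^\top\mathbf I_d)\boldsymbol\Upsilon_{d,k,r}\}\otimes\boldsymbol{\mathcal S}_{d^2,r}\big]\big\{(\operatorname{vec}\mathbf X)^{\otimes(k-r)}\otimes\operatorname{vec}\mathbf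 I_{d^{2r}}\big\}\in\mathbb R^{d^{2r}}.$$
   Context: Vectors are column vectors; $\mathcal M_{m\times n}$ is the set of real $m\times n$ matrices; $\mathbf I_n$ is the $n\times n$ identity; $\otimes$ is the Kronecker product, and $\boldsymbol A^{\otimes m}$ is the $m$-fold Kronecker power ($\boldsymbol A^{\otimes 1}=\boldsymbol A$, $\boldsymbol A^{\otimes 0}=1$). $\operatorname{vec}$ stacks the columns of a matrix underneath each other and $\operatorname{vec}^\top\mathbf A=(\operatorname{vec}\mathbf A)^\top$. $\mathbf K_{m,n}\in\mathcal M_{mn\times mn}$ is the commutation matrix: $\mathbf K_{m,n}\operatorname{vec}\mathbf A=\operatorname{vec}(\mathbf A^\top)$ for all $\mathbf A\in\mathcal M_{m\times n}$. Vectorized derivatives: for a scalar function $f$ of $\boldsymbol x\in\mathbb R^d$, $\mathsf D^{\otimes r}f(\boldsymbol x)\in\mathbb R^{d^r}$ is the vector whose entry at position $1+\sum_{j=1}^r(i_j-1)d^{r-j}$ is $\frac{\partial^r f}{\partial x_{i_1}\cdots\partial x_{i_r}}(\boldsymbol x)$. For $\boldsymbol f=(f_1,\dots,f_p)$, $\mathsf D^{\otimes r}\boldsymbol f$ is obtained by stacking $\mathsf D^{\otimes r}f_1,\dots,\mathsf D^{\otimes r}f_p$ underneath each other. For functions of a matrix variable $\mathbf X\in\mathcal M_{c\times d}$, derivatives are taken with respect to the vector variable $\operatorname{vec}\mathbf X\in\mathbb R^{cd}$; a matrix-valued function $\mathbf F$ is differentiated through $\operatorname{vec}\mathbf F$.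 Symmetrizer matrix: $\boldsymbol{\mathcal S}_{d,r}$ is the $d^r\times d^r$ matrix determined by $r!\,\boldsymbol{\mathcal S}_{d,r}(\boldsymbol v_1\otimes\cdots\otimes\boldsymbol v_r)=\sum_{\sigma\in\mathcal P_r}\boldsymbol v_{\sigma(1)}\otimes\cdots\otimes\boldsymbol v_{\sigma(r)}$ for all $\boldsymbol v_1,\dots,\boldsymbol v_r\in\mathbb R^d$, where $\mathcal P_r$ is the set of all permutations of $\{1,\dots,r\}$. *)

theory Defs
  imports
    "HOL-Analysis.Derivative"
    "HOL-Combinatorics.Permutations"
    "Jordan_Normal_Form.Matrix"
begin

hide_type (open) Finite_Cartesian_Product.vec
hide_const (open) Finite_Cartesian_Product.vec Finite_Cartesian_Product.mat
no_notation Finite_Cartesian_Product.vec.vec_nth (infixl \<open>$\<close> 90)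

text \<open>
  Since the dimensions \<open>b ^ k\<close>, \<open>d ^ (2 * r)\<close> etc. depend on the parameters of the statement,
  vectors and matrices have explicit dimensions (\<^typ>\<open>real vec\<close>, \<^typ>\<open>real mat\<close>).
  All indices are 0-based.
\<close>

definition kron_mat :: "real mat \<Rightarrow> real mat \<Rightarrow> real mat" (infixl \<open>\<otimes>\<^sub>m\<close> 72) where
  "A \<otimes>\<^sub>m B = mat (dim_row A * dim_row B) (dim_col A * dim_col B)
     (\<lambda>(i, j). A $$ (i div dim_row B, j div dim_col B) * B $$ (i mod dim_row B, j mod dim_col B))"

definition kron_vec :: "real vec \<Rightarrow> real vec \<Rightarrow> real vec" (infixl \<open>\<otimes>\<^sub>v\<close> 72) where
  "u \<otimes>\<^sub>v v = vec (dim_vec u * dim_vec v) (\<lambda>i. u $ (i div dim_vec v) * v $ (i mod dim_vec v))"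

primrec kron_mat_power :: "real mat \<Rightarrow> nat \<Rightarrow> real mat" where
  "kron_mat_power A 0 = 1\<^sub>m 1"
| "kron_mat_power A (Suc m) = A \<otimes>\<^sub>m kron_mat_power A m"

primrec kron_list :: "real vec list \<Rightarrow> real vec" where
  "kron_list [] = vec 1 (\<lambda>_. 1)"
| "kron_list (v # vs) = v \<otimes>\<^sub>v kron_list vs"

definition kron_vec_power :: "real vec \<Rightarrow> nat \<Rightarrow> real vec" where
  "kron_vec_power v m = kron_list (replicate m v)"

lemma kron_mat_carrier:
  "A \<in> carrier_mat m n \<Longrightarrow> B \<in> carrier_mat p q \<Longrightarrow> A \<otimes>\<^sub>m B \<in> carrier_mat (m * p) (n * q)"
  unfolding kron_mat_def by auto

lemma kron_mat_power_carrier: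
  "A \<in> carrier_mat m n \<Longrightarrow> kron_mat_power A k \<in> carrier_mat (m ^ k) (n ^ k)"
  by (induction k) (auto intro: kron_mat_carrier)

lemma kron_vec_carrier:
  "u \<in> carrier_vec m \<Longrightarrow> v \<in> carrier_vec n \<Longrightarrow> u \<otimes>\<^sub>v v \<in> carrier_vec (m * n)"
  unfolding kron_vec_def by auto

lemma kron_list_carrier:
  "set vs \<subseteq> carrier_vec d \<Longrightarrow> kron_list vs \<in> carrier_vec (d ^ length vs)"
  by (induction vs) (auto intro: kron_vec_carrier)

lemma kron_vec_power_carrier:
  "v \<in> carrier_vec d \<Longrightarrow> kron_vec_power v k \<in> carrier_vec (d ^ k)"
  using kron_list_carrier[of "replicate k v" d] by (simp add: kron_vec_power_def set_replicate_conv_if)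

lemma kron_vec_as_kron_mat:
  "mat_of_cols (dim_vec u * dim_vec v) [u \<otimes>\<^sub>v v] =
     mat_of_cols (dim_vec u) [u] \<otimes>\<^sub>m mat_of_cols (dim_vec v) [v]" (is "?L = ?R")
proof (rule eq_matI)
  fix i j assume "i < dim_row ?R" "j < dim_col ?R"
  hence i: "i < dim_vec u * dim_vec v" and j: "j = 0" by (auto simp: kron_mat_def)
  hence "0 < dim_vec v" by (cases "dim_vec v") auto
  thus "?L $$ (i, j) = ?R $$ (i, j)"
    using i j by (simp add: kron_vec_def kron_mat_def mat_of_cols_def less_mult_imp_div_less)
qed (auto simp: kron_mat_def)

definition vectorize :: "real mat \<Rightarrow> real vec" where
  "vectorize A = vec (dim_row A * dim_col A) (\<lambda>q. A $$ (q mod dim_row A, q div dim_row A))"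

definition unvectorize :: "nat \<Rightarrow> nat \<Rightarrow> real vec \<Rightarrow> real mat" where
  "unvectorize m n v = mat m n (\<lambda>(i, j). v $ (j * m + i))"

definition mat_trace :: "real mat \<Rightarrow> real" where
  "mat_trace A = (\<Sum>i<dim_row A. A $$ (i, i))"

lemma vectorize_carrier: "A \<in> carrier_mat m n \<Longrightarrow> vectorize A \<in> carrier_vec (m * n)"
  unfolding vectorize_def by auto

lemma index_lt_mult:
  fixes a b m n :: nat
  assumes "a < m" "b < n"
  shows "b * m + a < m * n"
proof -
  have "b * m + a < Suc b * m" using assms by simp
  also have "\<dots> \<le> n * m" using assms by (intro mult_right_mono) auto
  finally show ?thesis by (simp add: mult.commute)
qed

lemma vectorize_index:
  "A \<in> carrier_mat m n \<Longrightarrow> i < m \<Longrightarrow> j < n \<Longrightarrow> vectorize A $ (j * m + i) = A $$ (i, j)"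
  using index_lt_mult[of i m j n] by (auto simp: vectorize_def)

lemma unvectorize_vectorize: "A \<in> carrier_mat m n \<Longrightarrow> unvectorize m n (vectorize A) = A"
  by (rule eq_matI) (auto simp: unvectorize_def vectorize_index)

lemma vectorize_unvectorize: 
  assumes "v \<in> carrier_vec (m * n)"
  shows "vectorize (unvectorize m n v) = v"
proof (rule eq_vecI)
  fix q assume "q < dim_vec v"
  hence q: "q < m * n" using assms by simp
  hence m: "0 < m" by (cases m) auto
  have "q div m < n" using q by (simp add: less_mult_imp_div_less mult.commute)
  thus "vectorize (unvectorize m n v) $ q = v $ q"
    using q m by (simp add: vectorize_def unvectorize_def)
qed (use assms in \<open>auto simp: vectorize_def unvectorize_def\<close>)

definition is_commutation :: "nat \<Rightarrow> nat \<Rightarrow> real mat \<Rightarrow> bool" where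
  "is_commutation m n K \<longleftrightarrow> K \<in> carrier_mat (m * n) (m * n) \<and>
     (\<forall>A \<in> carrier_mat m n. K *\<^sub>v vectorize A = vectorize A\<^sup>T)"

definition commutation :: "nat \<Rightarrow> nat \<Rightarrow> real mat" where
  "commutation m n = (THE K. is_commutation m n K)"

lemma mat_eq_if_unit_vec:
  fixes A B :: "real mat"
  assumes A: "A \<in> carrier_mat m n" and B: "B \<in> carrier_mat m n"
    and eq: "\<And>j. j < n \<Longrightarrow> A *\<^sub>v unit_vec n j = B *\<^sub>v unit_vec n j"
  shows "A = B"
proof (rule eq_matI)
  fix i j assume "i < dim_row B" "j < dim_col B"
  hence ij: "i < m" "j < n" using B by auto
  have "(A *\<^sub>v unit_vec n j) $ i = (B *\<^sub>v unit_vec n j) $ i" using eq[OF ij(2)] by simp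
  thus "A $$ (i, j) = B $$ (i, j)" using A B ij by simp
qed (use A B in auto)

lemma ex1_commutation: "\<exists>!K. is_commutation m n K"
proof (rule ex_ex1I)
  let ?\<pi> = "\<lambda>p. (p mod n) * m + p div n"
  let ?K = "mat (m * n) (m * n) (\<lambda>(p, q). if q = ?\<pi> p then 1 else 0)"
  have "?K *\<^sub>v vectorize A = vectorize A\<^sup>T" if A: "A \<in> carrier_mat m n" for A
  proof (rule eq_vecI)
    show "dim_vec (?K *\<^sub>v vectorize A) = dim_vec (vectorize A\<^sup>T)"
      using A by (simp add: vectorize_def)
    fix p assume "p < dim_vec (vectorize A\<^sup>T)"
    hence p: "p < m * n" using A by (simp add: vectorize_def mult.commute)
    hence n: "0 < n" by (cases n) auto
    have d: "p div n < m" using p by (simp add: less_mult_imp_div_less)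
    have lt: "?\<pi> p < m * n" using index_lt_mult[OF d, of "p mod n" n] n by simp
    have "(?K *\<^sub>v vectorize A) $ p = (\<Sum>q<m * n. (if q = ?\<pi> p then 1 else 0) * vectorize A $ q)"
      using p vectorize_carrier[OF A] by (simp add: scalar_prod_def lessThan_atLeast0)
    also have "\<dots> = (\<Sum>q<m * n. if q = ?\<pi> p then vectorize A $ q else 0)"
      by (rule sum.cong) auto
    also have "\<dots> = vectorize A $ ?\<pi> p" using lt by simp
    also have "\<dots> = A $$ (p div n, p mod n)" using A d n by (intro vectorize_index) auto
    also have "\<dots> = vectorize A\<^sup>T $ p" using A p n d by (simp add: vectorize_def mult.commute)
    finally show "(?K *\<^sub>v vectorize A) $ p = vectorize A\<^sup>T $ p" .
  qed
  thus "\<exists>K. is_commutation m n K" unfolding is_commutation_def by (intro exI[of _ ?K]) auto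
next
  fix K L assume K: "is_commutation m n K" and L: "is_commutation m n L"
  show "K = L"
  proof (rule mat_eq_if_unit_vec)
    fix j
    let ?U = "unvectorize m n (unit_vec (m * n) j)"
    have "?U \<in> carrier_mat m n" by (simp add: unvectorize_def)
    moreover have "vectorize ?U = unit_vec (m * n) j" by (rule vectorize_unvectorize) simp
    ultimately show "K *\<^sub>v unit_vec (m * n) j = L *\<^sub>v unit_vec (m * n) j"
      using K L unfolding is_commutation_def by metis
  qed (use K L in \<open>auto simp: is_commutation_def\<close>)
qed

lemma commutation: "is_commutation m n (commutation m n)"
  unfolding commutation_def by (rule theI') (rule ex1_commutation)

text \<open>
  \<open>digit d r q j\<close> is the \<open>j\<close>-th index of the multi-index \<open>(i\<^sub>0, \<dots>, i\<^sub>r\<^sub>-\<^sub>1)\<close> that sits at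
  position \<open>q = (\<Sum>j<r. i\<^sub>j * d ^ (r - 1 - j))\<close>.
\<close>

definition digit :: "nat \<Rightarrow> nat \<Rightarrow> nat \<Rightarrow> nat \<Rightarrow> nat" where
  "digit d r q j = q div d ^ (r - 1 - j) mod d"

definition multi_index :: "nat \<Rightarrow> nat \<Rightarrow> nat \<Rightarrow> nat list" where
  "multi_index d r q = map (digit d r q) [0..<r]"

lemma digit_Suc_0: "q < d ^ Suc r \<Longrightarrow> digit d (Suc r) q 0 = q div d ^ r"
  by (simp add: digit_def less_mult_imp_div_less)

lemma digit_Suc_Suc:
  assumes "j < r"
  shows "digit d (Suc r) q (Suc j) = digit d r (q mod d ^ r) j"
proof -
  let ?e = "r - 1 - j"
  have r: "d ^ r = d ^ ?e * d ^ Suc j"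
    using assms by (subst power_add[symmetric]) simp
  have "q mod d ^ r div d ^ ?e = q div d ^ ?e mod d ^ Suc j"
    unfolding r by (cases "d = 0") (auto simp: mod_mult2_eq)
  hence "q mod d ^ r div d ^ ?e mod d = q div d ^ ?e mod d"
    by (simp add: mod_mod_cancel)
  thus ?thesis by (simp add: digit_def)
qed

lemma digit_less: "0 < d \<Longrightarrow> digit d r q j < d"
  by (simp add: digit_def)

lemma digit_position:
  assumes "\<And>j. j < r \<Longrightarrow> i j < d"
  shows "(\<Sum>j<r. i j * d ^ (r - 1 - j)) < d ^ r \<and>
    (\<forall>k<r. digit d r (\<Sum>j<r. i j * d ^ (r - 1 - j)) k = i k)"
  using assms
proof (induction r arbitrary: i)
  case (Suc r)
  let ?s = "\<Sum>j<r. i (Suc j) * d ^ (r - 1 - j)"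
  have IH: "?s < d ^ r" "\<And>k. k < r \<Longrightarrow> digit d r ?s k = i (Suc k)"
    using Suc.IH[of "\<lambda>j. i (Suc j)"] Suc.prems by auto
  have s: "(\<Sum>j<Suc r. i j * d ^ (Suc r - 1 - j)) = i 0 * d ^ r + ?s" (is "?t = _")
    by (subst sum.lessThan_Suc_shift) simp
  have lt: "?t < d ^ Suc r"
    using index_lt_mult[OF IH(1), of "i 0" d] Suc.prems[of 0] s by (simp add: mult.commute)
  have d0: "d ^ r \<noteq> 0" using IH(1) by linarith
  have "digit d (Suc r) ?t k = i k" if k: "k < Suc r" for k
  proof (cases k)
    case 0
    have "digit d (Suc r) ?t 0 = ?t div d ^ r" by (rule digit_Suc_0[OF lt])
    also have "\<dots> = i 0" unfolding s using IH(1) d0 by simp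
    finally show ?thesis using 0 by simp
  next
    case (Suc l)
    hence l: "l < r" using k by simp
    have "digit d (Suc r) ?t (Suc l) = digit d r (?t mod d ^ r) l" by (rule digit_Suc_Suc[OF l])
    also have "?t mod d ^ r = ?s" unfolding s using IH(1) by simp
    finally show ?thesis using IH(2)[OF l] Suc by simp
  qed
  with lt show ?case by blast
qed simp

lemma digit_inject:
  "p < d ^ r \<Longrightarrow> q < d ^ r \<Longrightarrow> (\<And>j. j < r \<Longrightarrow> digit d r p j = digit d r q j) \<Longrightarrow> p = q"
proof (induction r arbitrary: p q)
  case (Suc r)
  have pos: "0 < d ^ r" using Suc.prems(1) by (cases "d ^ r") auto
  have "p div d ^ r = q div d ^ r"
    using Suc.prems(3)[of 0] Suc.prems(1,2) by (simp add: digit_Suc_0)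
  moreover have "p mod d ^ r = q mod d ^ r"
  proof (rule Suc.IH)
    fix j assume "j < r"
    thus "digit d r (p mod d ^ r) j = digit d r (q mod d ^ r) j"
      using Suc.prems(3)[of "Suc j"] by (simp add: digit_Suc_Suc)
  qed (use pos in auto)
  ultimately show ?case by (metis div_mult_mod_eq)
qed simp

lemma kron_list_index:
  "set vs \<subseteq> carrier_vec d \<Longrightarrow> q < d ^ length vs \<Longrightarrow>
     kron_list vs $ q = (\<Prod>j<length vs. vs ! j $ digit d (length vs) q j)"
proof (induction vs arbitrary: q)
  case (Cons v vs)
  let ?n = "length vs"
  have c: "kron_list vs \<in> carrier_vec (d ^ ?n)" using Cons.prems by (intro kron_list_carrier) auto
  have v: "v \<in> carrier_vec d" using Cons.prems by auto
  have q: "q < d ^ Suc ?n" using Cons.prems by simp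
  have pos: "0 < d ^ ?n" using q by (cases "d ^ ?n") auto
  have "kron_list (v # vs) $ q = v $ (q div d ^ ?n) * kron_list vs $ (q mod d ^ ?n)"
    using c v q by (simp add: kron_vec_def)
  also have "kron_list vs $ (q mod d ^ ?n) = (\<Prod>j<?n. vs ! j $ digit d ?n (q mod d ^ ?n) j)"
    using Cons.prems pos by (intro Cons.IH) auto
  also have "\<dots> = (\<Prod>j<?n. (v # vs) ! Suc j $ digit d (Suc ?n) q (Suc j))"
    by (rule prod.cong) (auto simp: digit_Suc_Suc)
  finally have *: "kron_list (v # vs) $ q =
    v $ (q div d ^ ?n) * (\<Prod>j<?n. (v # vs) ! Suc j $ digit d (Suc ?n) q (Suc j))" .
  show ?case
    unfolding * list.size add_0_right add_Suc_right prod.lessThan_Suc_shift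
    using digit_Suc_0[OF q] by simp
qed simp

definition is_symmetrizer :: "nat \<Rightarrow> nat \<Rightarrow> real mat \<Rightarrow> bool" where
  "is_symmetrizer d r S \<longleftrightarrow> S \<in> carrier_mat (d ^ r) (d ^ r) \<and>
     (\<forall>vs. length vs = r \<and> set vs \<subseteq> carrier_vec d \<longrightarrow>
        fact r \<cdot>\<^sub>v (S *\<^sub>v kron_list vs) =
        finsum_vec TYPE(real) (d ^ r) (\<lambda>\<sigma>. kron_list (map (\<lambda>j. vs ! \<sigma> j) [0..<r]))
          {\<sigma>. \<sigma> permutes {..<r}})"

definition symmetrizer :: "nat \<Rightarrow> nat \<Rightarrow> real mat" where
  "symmetrizer d r = (THE S. is_symmetrizer d r S)"

lemma kron_list_unit_vec:
  assumes "0 < d" "q < d ^ r"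
  shows "kron_list (map (\<lambda>j. unit_vec d (digit d r q j)) [0..<r]) = unit_vec (d ^ r) q"
    (is "kron_list ?vs = _")
proof (rule eq_vecI)
  have c: "set ?vs \<subseteq> carrier_vec d" by auto
  show "dim_vec (kron_list ?vs) = dim_vec (unit_vec (d ^ r) q)"
    using kron_list_carrier[OF c] by auto
  fix p assume "p < dim_vec (unit_vec (d ^ r) q :: real vec)"
  hence p: "p < d ^ r" by simp
  have "kron_list ?vs $ p = (\<Prod>j<r. ?vs ! j $ digit d r p j)"
    using kron_list_index[OF c] p by simp
  also have "\<dots> = (\<Prod>j<r. if digit d r p j = digit d r q j then 1 else 0)"
    by (rule prod.cong) (auto simp: digit_less[OF assms(1)])
  also have "\<dots> = (if p = q then 1 else 0)"
    using digit_inject[OF p assms(2)] by auto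
  finally show "kron_list ?vs $ p = unit_vec (d ^ r) q $ p" using p assms by simp
qed

lemma ex1_symmetrizer:
  assumes d: "0 < d"
  shows "\<exists>!S. is_symmetrizer d r S"
proof (rule ex_ex1I)
  let ?P = "{\<sigma>. \<sigma> permutes {..<r}}"
  let ?m = "\<lambda>p q \<sigma>. \<forall>j<r. digit d r p j = digit d r q (\<sigma> j)"
  let ?S = "mat (d ^ r) (d ^ r) (\<lambda>(p, q). (\<Sum>\<sigma>\<in>?P. if ?m p q \<sigma> then 1 else 0) / fact r) :: real mat"
  have "fact r \<cdot>\<^sub>v (?S *\<^sub>v kron_list vs) =
      finsum_vec TYPE(real) (d ^ r) (\<lambda>\<sigma>. kron_list (map (\<lambda>j. vs ! \<sigma> j) [0..<r])) ?P"
    (is "?L = ?R") if len: "length vs = r" and vs: "set vs \<subseteq> carrier_vec d" for vs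
  proof (rule eq_vecI)
    have cl: "kron_list vs \<in> carrier_vec (d ^ r)" using kron_list_carrier[OF vs] len by simp
    have setp: "set (map (\<lambda>j. vs ! \<sigma> j) [0..<r]) \<subseteq> carrier_vec d" if "\<sigma> \<in> ?P" for \<sigma>
    proof
      fix v assume "v \<in> set (map (\<lambda>j. vs ! \<sigma> j) [0..<r])"
      then obtain j where j: "j < r" "v = vs ! \<sigma> j" by auto
      hence "\<sigma> j < r" using that permutes_in_image[of \<sigma> "{..<r}" j] by auto
      thus "v \<in> carrier_vec d" using vs len j by auto
    qed
    have cr: "(\<lambda>\<sigma>. kron_list (map (\<lambda>j. vs ! \<sigma> j) [0..<r])) \<in> ?P \<rightarrow> carrier_vec (d ^ r)"
    proof
      fix \<sigma> assume "\<sigma> \<in> ?P"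
      from kron_list_carrier[OF setp[OF this]]
      show "kron_list (map (\<lambda>j. vs ! \<sigma> j) [0..<r]) \<in> carrier_vec (d ^ r)" by simp
    qed
    have R: "?R \<in> carrier_vec (d ^ r)" by (rule finsum_vec_closed[OF cr])
    show "dim_vec ?L = dim_vec ?R" using R by simp
    fix p assume "p < dim_vec ?R"
    hence p: "p < d ^ r" using R by simp
    have key: "(\<Sum>q<d ^ r. (if ?m p q \<sigma> then 1 else 0) * kron_list vs $ q) =
        kron_list (map (\<lambda>j. vs ! \<sigma> j) [0..<r]) $ p" if s: "\<sigma> \<in> ?P" for \<sigma>
    proof -
      have s': "\<sigma> permutes {..<r}" using s by simp
      have lt: "\<And>j. j < r \<Longrightarrow> \<sigma> j < r" using permutes_in_image[OF s'] by auto
      define i where "i = (\<lambda>j. digit d r p (inv_into UNIV \<sigma> j))"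
      define q0 where "q0 = (\<Sum>j<r. i j * d ^ (r - 1 - j))"
      have "\<And>j. j < r \<Longrightarrow> i j < d" using digit_less[OF d] by (simp add: i_def)
      from digit_position[of r i d, OF this]
      have q0: "q0 < d ^ r" "\<And>j. j < r \<Longrightarrow> digit d r q0 j = i j" unfolding q0_def by auto
      have inv: "inv_into UNIV \<sigma> (\<sigma> j) = j" "\<sigma> (inv_into UNIV \<sigma> j) = j" for j
        using permutes_inverses[OF s'] by auto
      have ltinv: "\<And>j. j < r \<Longrightarrow> inv_into UNIV \<sigma> j < r"
        using permutes_in_image[OF permutes_inv[OF s']] by auto
      have iff: "?m p q \<sigma> \<longleftrightarrow> q = q0" if q: "q < d ^ r" for q
      proof
        assume m: "?m p q \<sigma>"
        show "q = q0"
        proof (rule digit_inject[OF q q0(1)])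
          fix j assume j: "j < r"
          show "digit d r q j = digit d r q0 j"
            using m[rule_format, OF ltinv[OF j]] q0(2)[OF j] inv by (simp add: i_def)
        qed
      next
        assume "q = q0"
        thus "?m p q \<sigma>" using q0(2)[OF lt] inv by (simp add: i_def)
      qed
      have "(\<Sum>q<d ^ r. (if ?m p q \<sigma> then 1 else 0) * kron_list vs $ q) =
          (\<Sum>q<d ^ r. if q = q0 then kron_list vs $ q else 0)"
      proof (rule sum.cong)
        fix q assume "q \<in> {..<d ^ r}"
        hence "?m p q \<sigma> \<longleftrightarrow> q = q0" by (intro iff) simp
        thus "(if ?m p q \<sigma> then 1 else 0) * kron_list vs $ q =
          (if q = q0 then kron_list vs $ q else 0)" by simp
      qed simp
      also have "\<dots> = kron_list vs $ q0" using q0(1) by simp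
      also have "\<dots> = (\<Prod>j<r. vs ! j $ i j)"
        using kron_list_index[OF vs] q0 len by simp
      also have "\<dots> = (\<Prod>j<r. vs ! \<sigma> j $ i (\<sigma> j))"
        using prod.permute[OF s', of "\<lambda>j. vs ! j $ i j"] by (simp add: o_def)
      also have "\<dots> = (\<Prod>j<r. map (\<lambda>j. vs ! \<sigma> j) [0..<r] ! j $ digit d r p j)"
        by (rule prod.cong) (auto simp: i_def inv)
      also have "\<dots> = kron_list (map (\<lambda>j. vs ! \<sigma> j) [0..<r]) $ p"
        using kron_list_index[OF setp[OF s], of p] p by simp
      finally show ?thesis .
    qed
    have "?L $ p = fact r * (\<Sum>q<d ^ r.
        (\<Sum>\<sigma>\<in>?P. if ?m p q \<sigma> then 1 else 0) / fact r * kron_list vs $ q)"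
      using p cl by (simp add: scalar_prod_def lessThan_atLeast0)
    also have "\<dots> = (\<Sum>q<d ^ r. \<Sum>\<sigma>\<in>?P. (if ?m p q \<sigma> then 1 else 0) * kron_list vs $ q)"
      unfolding sum_distrib_left by (intro sum.cong refl) (simp add: sum_distrib_right)
    also have "\<dots> = (\<Sum>\<sigma>\<in>?P. \<Sum>q<d ^ r. (if ?m p q \<sigma> then 1 else 0) * kron_list vs $ q)"
      by (rule sum.swap)
    also have "\<dots> = (\<Sum>\<sigma>\<in>?P. kron_list (map (\<lambda>j. vs ! \<sigma> j) [0..<r]) $ p)"
      by (rule sum.cong[OF refl key])
    also have "\<dots> = ?R $ p"
      by (rule index_finsum_vec[symmetric]) (use p cr in \<open>auto simp: finite_permutations\<close>)
    finally show "?L $ p = ?R $ p" .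
  qed
  thus "\<exists>S. is_symmetrizer d r S" unfolding is_symmetrizer_def by (intro exI[of _ ?S]) auto
next
  fix S T assume S: "is_symmetrizer d r S" and T: "is_symmetrizer d r T"
  have Sc: "S \<in> carrier_mat (d ^ r) (d ^ r)" and Tc: "T \<in> carrier_mat (d ^ r) (d ^ r)"
    using S T by (auto simp: is_symmetrizer_def)
  show "S = T"
  proof (rule mat_eq_if_unit_vec[OF Sc Tc])
    fix q assume q: "q < d ^ r"
    let ?vs = "map (\<lambda>j. unit_vec d (digit d r q j)) [0..<r] :: real vec list"
    have "length ?vs = r" "set ?vs \<subseteq> carrier_vec d" by auto
    hence "fact r \<cdot>\<^sub>v (S *\<^sub>v kron_list ?vs) = fact r \<cdot>\<^sub>v (T *\<^sub>v kron_list ?vs)"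
      using S T unfolding is_symmetrizer_def by metis
    hence e: "fact r \<cdot>\<^sub>v (S *\<^sub>v unit_vec (d ^ r) q) = fact r \<cdot>\<^sub>v (T *\<^sub>v unit_vec (d ^ r) q)"
      unfolding kron_list_unit_vec[OF d q] .
    show "S *\<^sub>v unit_vec (d ^ r) q = T *\<^sub>v unit_vec (d ^ r) q"
    proof (rule eq_vecI)
      fix p assume p: "p < dim_vec (T *\<^sub>v unit_vec (d ^ r) q)"
      have "(fact r \<cdot>\<^sub>v (S *\<^sub>v unit_vec (d ^ r) q)) $ p = (fact r \<cdot>\<^sub>v (T *\<^sub>v unit_vec (d ^ r) q)) $ p"
        by (simp only: e)
      thus "(S *\<^sub>v unit_vec (d ^ r) q) $ p = (T *\<^sub>v unit_vec (d ^ r) q) $ p"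
        using p Sc Tc by (simp del: index_mult_mat_vec)
    qed (use Sc Tc in auto)
  qed
qed

lemma symmetrizer: "0 < d \<Longrightarrow> is_symmetrizer d r (symmetrizer d r)"
  unfolding symmetrizer_def by (rule theI') (rule ex1_symmetrizer)

definition partial :: "nat \<Rightarrow> (real vec \<Rightarrow> real) \<Rightarrow> real vec \<Rightarrow> real" where
  "partial i f x = deriv (\<lambda>t. f (x + t \<cdot>\<^sub>v unit_vec (dim_vec x) i)) 0"

primrec mixed_partial :: "nat list \<Rightarrow> (real vec \<Rightarrow> real) \<Rightarrow> real vec \<Rightarrow> real" where
  "mixed_partial [] f = f"
| "mixed_partial (i # is) f = partial i (mixed_partial is f)"

text \<open>
  \<^const>\<open>deriv\<close> is total; the following predicate says that all partial derivatives of order up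
  to \<open>r\<close> really exist, everywhere on \<open>\<real>\<^sup>d\<close>.
\<close>

definition has_partials :: "nat \<Rightarrow> nat \<Rightarrow> (real vec \<Rightarrow> real) \<Rightarrow> bool" where
  "has_partials d r f \<longleftrightarrow>
     (\<forall>is i. \<forall>x \<in> carrier_vec d. length is < r \<and> set is \<subseteq> {..<d} \<and> i < d \<longrightarrow>
        (\<lambda>t. mixed_partial is f (x + t \<cdot>\<^sub>v unit_vec d i)) field_differentiable (at 0))"

definition has_partials_vec :: "nat \<Rightarrow> nat \<Rightarrow> nat \<Rightarrow> (real vec \<Rightarrow> real vec) \<Rightarrow> bool" where
  "has_partials_vec d p r f \<longleftrightarrow>
     f \<in> carrier_vec d \<rightarrow> carrier_vec p \<and> (\<forall>l<p. has_partials d r (\<lambda>x. f x $ l))"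

definition tensor_deriv :: "nat \<Rightarrow> (real vec \<Rightarrow> real) \<Rightarrow> real vec \<Rightarrow> real vec" where
  "tensor_deriv r f x =
     vec (dim_vec x ^ r) (\<lambda>q. mixed_partial (multi_index (dim_vec x) r q) f x)"

definition tensor_deriv_vec :: "nat \<Rightarrow> (real vec \<Rightarrow> real vec) \<Rightarrow> real vec \<Rightarrow> real vec" where
  "tensor_deriv_vec r f x =
     vec (dim_vec (f x) * dim_vec x ^ r)
       (\<lambda>q. tensor_deriv r (\<lambda>y. f y $ (q div dim_vec x ^ r)) x $ (q mod dim_vec x ^ r))"

lemma tensor_deriv_position:
  assumes "x \<in> carrier_vec d" "length is = r" "set is \<subseteq> {..<d}"
  shows "tensor_deriv r f x $ (\<Sum>j<r. is ! j * d ^ (r - 1 - j)) = mixed_partial is f x"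
proof -
  let ?q = "\<Sum>j<r. is ! j * d ^ (r - 1 - j)"
  have "\<And>j. j < r \<Longrightarrow> is ! j < d" using assms by (metis lessThan_iff nth_mem subsetD)
  from digit_position[of r "\<lambda>j. is ! j" d, OF this]
  have q: "?q < d ^ r" "\<And>k. k < r \<Longrightarrow> digit d r ?q k = is ! k" by auto
  have "multi_index d r ?q = is"
    using q(2) assms(2) by (intro nth_equalityI) (simp_all add: multi_index_def)
  thus ?thesis using q(1) assms(1) by (simp add: tensor_deriv_def)
qed

text \<open>A function of an \<open>m \<times> n\<close> matrix \<open>X\<close>, as a function of the vector variable \<open>vec X\<close>.\<close>

definition of_vectorized :: "nat \<Rightarrow> nat \<Rightarrow> (real mat \<Rightarrow> 'a) \<Rightarrow> real vec \<Rightarrow> 'a" where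
  "of_vectorized m n F = (\<lambda>v. F (unvectorize m n v))"

definition Lambda_mat :: "nat \<Rightarrow> nat \<Rightarrow> real mat" where
  "Lambda_mat b k =
     mat (b ^ k) (b ^ k) (\<lambda>pq. \<Sum>j = 1..k. commutation (b ^ j) (b ^ (k - j)) $$ pq)"

primrec Gamma_mat :: "nat \<Rightarrow> nat \<Rightarrow> nat \<Rightarrow> real mat" where
  "Gamma_mat b k 0 = 1\<^sub>m (b ^ k)"
| "Gamma_mat b k (Suc r) = Gamma_mat b k r * (Lambda_mat b (k - r) \<otimes>\<^sub>m 1\<^sub>m (b ^ r))"

definition Upsilon_mat :: "nat \<Rightarrow> nat \<Rightarrow> nat \<Rightarrow> real mat" where
  "Upsilon_mat d k r =
     (1\<^sub>m d \<otimes>\<^sub>m kron_mat_power (mat_of_row (vectorize (1\<^sub>m d))) (k - 1) \<otimes>\<^sub>m 1\<^sub>m d) *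
     Gamma_mat (d ^ 2) k r"

lemma Gamma_mat_carrier: "r \<le> k \<Longrightarrow> Gamma_mat b k r \<in> carrier_mat (b ^ k) (b ^ k)"
proof (induction r)
  case (Suc r)
  have "Lambda_mat b (k - r) \<otimes>\<^sub>m 1\<^sub>m (b ^ r) \<in> carrier_mat (b ^ (k - r) * b ^ r) (b ^ (k - r) * b ^ r)"
    by (intro kron_mat_carrier) (auto simp: Lambda_mat_def)
  moreover have "b ^ (k - r) * b ^ r = b ^ k"
    using Suc.prems by (simp add: power_add[symmetric])
  ultimately show ?case using Suc by (auto intro: mult_carrier_mat)
qed auto

lemma Upsilon_mat_carrier:
  assumes "1 \<le> k" "r \<le> k"
  shows "Upsilon_mat d k r \<in> carrier_mat (d ^ 2) (d ^ (2 * k))"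
proof -
  have "mat_of_row (vectorize (1\<^sub>m d)) \<in> carrier_mat 1 (d * d)"
    by (auto simp: mat_of_row_def vectorize_def)
  hence "1\<^sub>m d \<otimes>\<^sub>m kron_mat_power (mat_of_row (vectorize (1\<^sub>m d))) (k - 1) \<otimes>\<^sub>m 1\<^sub>m d
      \<in> carrier_mat (d * 1 ^ (k - 1) * d) (d * (d * d) ^ (k - 1) * d)"
    by (intro kron_mat_carrier kron_mat_power_carrier) auto
  moreover have "d * 1 ^ (k - 1) * d = d ^ 2" by (simp add: power2_eq_square)
  moreover have "d * (d * d) ^ (k - 1) * d = (d ^ 2) ^ k"
    using assms(1) by (cases k) (auto simp: power2_eq_square)
  ultimately show ?thesis
    using Gamma_mat_carrier[OF assms(2), of "d ^ 2"]
    by (auto simp: Upsilon_mat_def power_mult intro: mult_carrier_mat)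
qed

end

theory Submission
  imports Defs
begin

text \<open>
  All four maps have the form \<open>x \<mapsto> M x\<^sup>\<otimes>\<^sup>k\<close> with a constant matrix \<open>M\<close>, so everything rests on the
  derivatives of \<open>x\<^sup>\<otimes>\<^sup>k\<close> itself. By the product rule, \<open>\<partial>\<^sub>i x\<^sup>\<otimes>\<^sup>k\<close> is the sum of the \<open>k\<close> products that arise
  from \<open>x \<otimes> \<dots> \<otimes> x\<close> by replacing one factor by the unit vector \<open>e\<^sub>i\<close>. These are exactly the cyclic
  rotations of \<open>x \<otimes> \<dots> \<otimes> x \<otimes> e\<^sub>i\<close>, and since a commutation matrix exchanges two blocks of a Kronecker
  product, \<open>\<Lambda>\<close> sums all cyclic rotations. Writing \<open>\<Lambda>\<^sub>k\<close> and \<open>\<Gamma>\<^bsub>k,r\<^esub>\<close> without the dimension \<open>b\<close>,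
  which is fixed,
    \<open>\<partial>\<^sub>i x\<^sup>\<otimes>\<^sup>k = \<Lambda>\<^sub>k (x\<^bsup>\<otimes>(k-1)\<^esup> \<otimes> e\<^sub>i)\<close>.
  On the right only \<open>x\<^bsup>\<otimes>(k-1)\<^esup>\<close> depends on \<open>x\<close>. The remaining partial derivatives therefore pass through
  the linear map \<open>\<Lambda>\<^sub>k (_ \<otimes> e\<^sub>i)\<close>, and since \<open>\<Gamma>\<^bsub>k,r\<^esub> = \<Lambda>\<^sub>k (\<Gamma>\<^bsub>k-1,r-1\<^esub> \<otimes> I)\<close>, induction on \<open>r\<close> gives
    \<open>\<partial>\<^bsub>i(1)\<^esub> \<dots> \<partial>\<^bsub>i(r)\<^esub> x\<^sup>\<otimes>\<^sup>k = \<Gamma>\<^bsub>k,r\<^esub> (x\<^bsup>\<otimes>(k-r)\<^esup> \<otimes> e\<^bsub>i(1)\<^esub> \<otimes> \<dots> \<otimes> e\<^bsub>i(r)\<^esub>)\<close>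
  without any counting of positions (lemma \<open>mixed_partial_kron_vec_power\<close>).

  As \<open>vec I = (\<Sum>q. e\<^sub>q \<otimes> e\<^sub>q)\<close>, the vector \<open>(\<Gamma>\<^bsub>k,r\<^esub> \<otimes> \<S>) (x\<^bsup>\<otimes>(k-r)\<^esup> \<otimes> vec I)\<close> lists, for every multi-index
  \<open>q\<close>, the average of these mixed partials over the rearrangements of \<open>q\<close>. The functions are polynomial,
  so their partial derivatives commute (\<open>mixed_partial_symmetric\<close>) and the average is the mixed partial
  of \<open>q\<close> itself (\<open>symmetrizer_fixes_symmetric\<close>). Multiplication by \<open>M\<close> commutes with all of this, which
  gives \<open>tensor_deriv_vec_mult_kron_power\<close>.

  In the first two parts \<open>M\<close> is the identity. For the matrix power, \<open>(vec X)\<^sup>\<otimes>\<^sup>k\<close> lists all products of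
  \<open>k\<close> entries of \<open>X\<close>, and \<open>M\<close> selects and adds those in which the row index of each factor equals the
  column index of the next one (\<open>contraction_kron_power\<close>). For the trace, multiplication by \<open>vec\<^sup>T I\<close>
  identifies the two outer indices as well.
\<close>

section \<open>Kronecker products by block indices\<close>

lemma block_index_less: "i < m \<Longrightarrow> j < n \<Longrightarrow> i * n + j < m * (n :: nat)"
  using index_lt_mult[of j n i m] by (simp add: mult.commute)

lemma block_indexE:
  fixes s m n :: nat
  assumes "s < m * n"
  obtains i j where "i < m" "j < n" "s = i * n + j"
proof -
  have "0 < n" using assms by (cases n) auto
  thus thesis using that[of "s div n" "s mod n"] assms by (simp add: less_mult_imp_div_less)
qed

lemma sum_block_index: "(\<Sum>s<m * n. f s) = (\<Sum>i<m. \<Sum>j<n. f (i * n + j))" for m n :: nat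
proof -
  have "sum f {i * n..<i * n + n} = (\<Sum>j<n. f (i * n + j))" for i
    using sum.shift_bounds_nat_ivl[of f 0 "i * n" n] by (simp add: add.commute lessThan_atLeast0)
  thus ?thesis using sum.nat_group[of f n m] by simp
qed

text \<open>
  At an index written as \<open>i * n + j\<close> the entry of a Kronecker product is a product of two entries.
  Comparing entries at such indices keeps \<open>div\<close> and \<open>mod\<close> out of the proofs about Kronecker products.
\<close>

lemma eq_vec_blockI:
  assumes "u \<in> carrier_vec (m * n)" "v \<in> carrier_vec (m * n)"
    and "\<And>i j. i < m \<Longrightarrow> j < n \<Longrightarrow> u $ (i * n + j) = v $ (i * n + j)"
  shows "u = v"
proof (rule eq_vecI)
  fix s assume "s < dim_vec v"
  then obtain i j where "i < m" "j < n" "s = i * n + j"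
    using assms(2) by (auto elim: block_indexE)
  thus "u $ s = v $ s" using assms(3) by simp
qed (use assms in auto)

lemma eq_mat_blockI:
  assumes "A \<in> carrier_mat (m * p) (n * q)" "B \<in> carrier_mat (m * p) (n * q)"
    and "\<And>i j k l. i < m \<Longrightarrow> j < p \<Longrightarrow> k < n \<Longrightarrow> l < q \<Longrightarrow>
      A $$ (i * p + j, k * q + l) = B $$ (i * p + j, k * q + l)"
  shows "A = B"
proof (rule eq_matI)
  fix s t assume "s < dim_row B" "t < dim_col B"
  hence "s < m * p" "t < n * q" using assms(2) by auto
  then obtain i j k l where "i < m" "j < p" "s = i * p + j" "k < n" "l < q" "t = k * q + l"
    by (auto elim!: block_indexE)
  thus "A $$ (s, t) = B $$ (s, t)" using assms(3) by simp
qed (use assms in auto)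

lemma kron_vec_index:
  "u \<in> carrier_vec m \<Longrightarrow> v \<in> carrier_vec n \<Longrightarrow> i < m \<Longrightarrow> j < n \<Longrightarrow>
    (u \<otimes>\<^sub>v v) $ (i * n + j) = u $ i * v $ j"
  using block_index_less[of i m j n] by (auto simp: kron_vec_def)

lemma kron_mat_index:
  "A \<in> carrier_mat m n \<Longrightarrow> B \<in> carrier_mat p q \<Longrightarrow> i < m \<Longrightarrow> j < p \<Longrightarrow> k < n \<Longrightarrow> l < q \<Longrightarrow>
    (A \<otimes>\<^sub>m B) $$ (i * p + j, k * q + l) = A $$ (i, k) * B $$ (j, l)"
  using block_index_less[of i m j p] block_index_less[of k n l q] by (auto simp: kron_mat_def)

lemma mult_mat_vec_index_sum:
  "A \<in> carrier_mat m n \<Longrightarrow> v \<in> carrier_vec n \<Longrightarrow> i < m \<Longrightarrow>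
    (A *\<^sub>v v) $ i = (\<Sum>s<n. A $$ (i, s) * v $ s)"
  by (auto simp: scalar_prod_def lessThan_atLeast0)

lemma mult_mat_index_sum:
  "A \<in> carrier_mat m n \<Longrightarrow> B \<in> carrier_mat n p \<Longrightarrow> i < m \<Longrightarrow> j < p \<Longrightarrow>
    (A * B) $$ (i, j) = (\<Sum>s<n. A $$ (i, s) * B $$ (s, j))"
  by (auto simp: scalar_prod_def lessThan_atLeast0)

lemma kron_vec_assoc: "(u \<otimes>\<^sub>v v) \<otimes>\<^sub>v w = u \<otimes>\<^sub>v (v \<otimes>\<^sub>v w)"
proof -
  define m n p where "m = dim_vec u" "n = dim_vec v" "p = dim_vec w"
  hence c: "u \<in> carrier_vec m" "v \<in> carrier_vec n" "w \<in> carrier_vec p"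
    by (auto intro: carrier_vecI)
  note k = kron_vec_carrier[OF c(1,2)] kron_vec_carrier[OF c(2,3)]
  show ?thesis
  proof (rule eq_vec_blockI[of _ "m * n" p])
    show "(u \<otimes>\<^sub>v v) \<otimes>\<^sub>v w \<in> carrier_vec (m * n * p)" by (intro kron_vec_carrier c)
    show "u \<otimes>\<^sub>v (v \<otimes>\<^sub>v w) \<in> carrier_vec (m * n * p)"
      unfolding mult.assoc by (intro kron_vec_carrier c)
    fix s l assume "s < m * n" and l: "l < p"
    then obtain i j where ij: "i < m" "j < n" and s: "s = i * n + j" by (elim block_indexE)
    have "(u \<otimes>\<^sub>v (v \<otimes>\<^sub>v w)) $ (i * (n * p) + (j * p + l)) = u $ i * (v $ j * w $ l)"
      using kron_vec_index[OF c(1) k(2) ij(1) block_index_less[OF ij(2) l]]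
        kron_vec_index[OF c(2,3) ij(2) l] by simp
    moreover have "((u \<otimes>\<^sub>v v) \<otimes>\<^sub>v w) $ (s * p + l) = u $ i * v $ j * w $ l"
      using kron_vec_index[OF k(1) c(3) \<open>s < m * n\<close> l] kron_vec_index[OF c(1,2) ij] s by simp
    ultimately show "((u \<otimes>\<^sub>v v) \<otimes>\<^sub>v w) $ (s * p + l) = (u \<otimes>\<^sub>v (v \<otimes>\<^sub>v w)) $ (s * p + l)"
      by (simp add: s algebra_simps)
  qed
qed

lemma kron_mat_assoc: "(A \<otimes>\<^sub>m B) \<otimes>\<^sub>m C = A \<otimes>\<^sub>m (B \<otimes>\<^sub>m C)"
proof -
  define m n p where mnp: "m = dim_row A" "n = dim_row B" "p = dim_row C"
  define m' n' p' where mnp': "m' = dim_col A" "n' = dim_col B" "p' = dim_col C"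
  have c: "A \<in> carrier_mat m m'" "B \<in> carrier_mat n n'" "C \<in> carrier_mat p p'"
    by (auto simp: mnp mnp')
  note k = kron_mat_carrier[OF c(1,2)] kron_mat_carrier[OF c(2,3)]
  show ?thesis
  proof (rule eq_mat_blockI[of _ "m * n" p "m' * n'" p'])
    show "(A \<otimes>\<^sub>m B) \<otimes>\<^sub>m C \<in> carrier_mat (m * n * p) (m' * n' * p')"
      by (intro kron_mat_carrier c)
    show "A \<otimes>\<^sub>m (B \<otimes>\<^sub>m C) \<in> carrier_mat (m * n * p) (m' * n' * p')"
      unfolding mult.assoc by (intro kron_mat_carrier c)
    fix s l s' l' assume st: "s < m * n" "s' < m' * n'" and l: "l < p" and l': "l' < p'"
    obtain i j where ij: "i < m" "j < n" and s: "s = i * n + j" using st(1) by (elim block_indexE)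
    obtain i' j' where ij': "i' < m'" "j' < n'" and s': "s' = i' * n' + j'"
      using st(2) by (elim block_indexE)
    have "(A \<otimes>\<^sub>m (B \<otimes>\<^sub>m C)) $$ (i * (n * p) + (j * p + l), i' * (n' * p') + (j' * p' + l')) =
        A $$ (i, i') * (B $$ (j, j') * C $$ (l, l'))"
      using kron_mat_index[OF c(1) k(2) ij(1) block_index_less[OF ij(2) l]
          ij'(1) block_index_less[OF ij'(2) l']]
        kron_mat_index[OF c(2,3) ij(2) l ij'(2) l'] by simp
    moreover have "((A \<otimes>\<^sub>m B) \<otimes>\<^sub>m C) $$ (s * p + l, s' * p' + l') =
        A $$ (i, i') * B $$ (j, j') * C $$ (l, l')"
      using kron_mat_index[OF k(1) c(3) st(1) l st(2) l']
        kron_mat_index[OF c(1,2) ij ij'] s s' by simp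
    ultimately show "((A \<otimes>\<^sub>m B) \<otimes>\<^sub>m C) $$ (s * p + l, s' * p' + l') =
        (A \<otimes>\<^sub>m (B \<otimes>\<^sub>m C)) $$ (s * p + l, s' * p' + l')"
      by (simp add: s s' algebra_simps)
  qed
qed

lemma kron_mat_mult:
  assumes A: "A \<in> carrier_mat m n" and B: "B \<in> carrier_mat p q"
    and C: "C \<in> carrier_mat n n'" and D: "D \<in> carrier_mat q q'"
  shows "(A \<otimes>\<^sub>m B) * (C \<otimes>\<^sub>m D) = (A * C) \<otimes>\<^sub>m (B * D)"
proof (rule eq_mat_blockI[of _ m p n' q'])
  note k = kron_mat_carrier[OF A B] kron_mat_carrier[OF C D]
  note l = mult_carrier_mat[OF A C] mult_carrier_mat[OF B D]
  show "(A \<otimes>\<^sub>m B) * (C \<otimes>\<^sub>m D) \<in> carrier_mat (m * p) (n' * q')"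
    by (rule mult_carrier_mat[OF k])
  show "(A * C) \<otimes>\<^sub>m (B * D) \<in> carrier_mat (m * p) (n' * q')" by (rule kron_mat_carrier[OF l])
  fix i j i' j' assume ij: "i < m" "j < p" and ij': "i' < n'" "j' < q'"
  have "((A \<otimes>\<^sub>m B) * (C \<otimes>\<^sub>m D)) $$ (i * p + j, i' * q' + j') =
      (\<Sum>s<n. \<Sum>t<q. (A $$ (i, s) * B $$ (j, t)) * (C $$ (s, i') * D $$ (t, j')))"
    unfolding mult_mat_index_sum[OF k block_index_less[OF ij] block_index_less[OF ij']]
      sum_block_index
    by (intro sum.cong refl)
      (simp add: kron_mat_index[OF A B ij] kron_mat_index[OF C D _ _ ij'])
  also have "\<dots> = (\<Sum>s<n. A $$ (i, s) * C $$ (s, i')) * (\<Sum>t<q. B $$ (j, t) * D $$ (t, j'))"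
    by (simp add: sum_product algebra_simps)
  also have "\<dots> = ((A * C) \<otimes>\<^sub>m (B * D)) $$ (i * p + j, i' * q' + j')"
    unfolding kron_mat_index[OF l ij ij'] mult_mat_index_sum[OF A C ij(1) ij'(1)]
      mult_mat_index_sum[OF B D ij(2) ij'(2)] ..
  finally show "((A \<otimes>\<^sub>m B) * (C \<otimes>\<^sub>m D)) $$ (i * p + j, i' * q' + j') =
      ((A * C) \<otimes>\<^sub>m (B * D)) $$ (i * p + j, i' * q' + j')" .
qed

lemma kron_mat_mult_vec:
  assumes A: "A \<in> carrier_mat m n" and B: "B \<in> carrier_mat p q"
    and u: "u \<in> carrier_vec n" and v: "v \<in> carrier_vec q"
  shows "(A \<otimes>\<^sub>m B) *\<^sub>v (u \<otimes>\<^sub>v v) = (A *\<^sub>v u) \<otimes>\<^sub>v (B *\<^sub>v v)"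
proof (rule eq_vec_blockI[of _ m p])
  note k = kron_mat_carrier[OF A B] kron_vec_carrier[OF u v]
  note l = mult_mat_vec_carrier[OF A u] mult_mat_vec_carrier[OF B v]
  show "(A \<otimes>\<^sub>m B) *\<^sub>v (u \<otimes>\<^sub>v v) \<in> carrier_vec (m * p)" by (rule mult_mat_vec_carrier[OF k])
  show "(A *\<^sub>v u) \<otimes>\<^sub>v (B *\<^sub>v v) \<in> carrier_vec (m * p)" by (rule kron_vec_carrier[OF l])
  fix i j assume ij: "i < m" "j < p"
  have "((A \<otimes>\<^sub>m B) *\<^sub>v (u \<otimes>\<^sub>v v)) $ (i * p + j) =
      (\<Sum>s<n. \<Sum>t<q. (A $$ (i, s) * B $$ (j, t)) * (u $ s * v $ t))"
    unfolding mult_mat_vec_index_sum[OF k block_index_less[OF ij]] sum_block_index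
    by (intro sum.cong refl) (simp add: kron_mat_index[OF A B ij] kron_vec_index[OF u v])
  also have "\<dots> = (\<Sum>s<n. A $$ (i, s) * u $ s) * (\<Sum>t<q. B $$ (j, t) * v $ t)"
    by (simp add: sum_product algebra_simps)
  also have "\<dots> = ((A *\<^sub>v u) \<otimes>\<^sub>v (B *\<^sub>v v)) $ (i * p + j)"
    unfolding kron_vec_index[OF l ij] mult_mat_vec_index_sum[OF A u ij(1)]
      mult_mat_vec_index_sum[OF B v ij(2)] ..
  finally show "((A \<otimes>\<^sub>m B) *\<^sub>v (u \<otimes>\<^sub>v v)) $ (i * p + j) =
      ((A *\<^sub>v u) \<otimes>\<^sub>v (B *\<^sub>v v)) $ (i * p + j)" .
qed

lemma kron_mat_one_one: "1\<^sub>m m \<otimes>\<^sub>m 1\<^sub>m n = 1\<^sub>m (m * n)"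
proof (rule eq_mat_blockI[of _ m n m n])
  fix i j k l assume a: "i < m" "j < n" "k < m" "l < n"
  hence "(i * n + j) div n = i" "(i * n + j) mod n = j"
    "(k * n + l) div n = k" "(k * n + l) mod n = l"
    by auto
  hence "i * n + j = k * n + l \<longleftrightarrow> i = k \<and> j = l" by metis
  thus "(1\<^sub>m m \<otimes>\<^sub>m 1\<^sub>m n) $$ (i * n + j, k * n + l) =
      (1\<^sub>m (m * n) :: real mat) $$ (i * n + j, k * n + l)"
    using a block_index_less[of i m j n] block_index_less[of k m l n]
    by (subst kron_mat_index[of _ m m _ n n]) auto
qed (auto intro: kron_mat_carrier)

lemma kron_mat_one_right: "A \<otimes>\<^sub>m 1\<^sub>m 1 = A"
  by (rule eq_matI) (auto simp: kron_mat_def)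

lemma kron_list_append: "kron_list (us @ vs) = kron_list us \<otimes>\<^sub>v kron_list vs"
proof (induction us)
  case Nil
  show ?case by (rule eq_vecI) (auto simp: kron_vec_def)
qed (simp add: kron_vec_assoc)

lemma kron_list_single: "kron_list [v] = v"
  by (rule eq_vecI) (auto simp: kron_vec_def)

lemma kron_vec_power_add: "kron_vec_power x (m + n) = kron_vec_power x m \<otimes>\<^sub>v kron_vec_power x n"
  by (simp add: kron_vec_power_def replicate_add kron_list_append)

lemma kron_vec_power_Suc: "kron_vec_power x (Suc n) = x \<otimes>\<^sub>v kron_vec_power x n"
  by (simp add: kron_vec_power_def)

lemma kron_vec_power_one: "kron_vec_power x (Suc 0) = x"
  by (simp add: kron_vec_power_def kron_list_single del: kron_list.simps)

section \<open>Commutation, rotation and the matrices Lambda and Gamma\<close>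

text \<open>Read off from \<open>A = v u\<^sup>T\<close>, for which \<open>vec A = u \<otimes> v\<close> and \<open>vec (A\<^sup>T) = v \<otimes> u\<close>.\<close>

lemma commutation_mult_kron:
  assumes u: "u \<in> carrier_vec n" and v: "v \<in> carrier_vec m"
  shows "commutation m n *\<^sub>v (u \<otimes>\<^sub>v v) = v \<otimes>\<^sub>v u"
proof -
  let ?A = "mat m n (\<lambda>(i, j). v $ i * u $ j)"
  have A: "?A \<in> carrier_mat m n" "?A\<^sup>T \<in> carrier_mat n m" by auto
  have "vectorize ?A = u \<otimes>\<^sub>v v"
  proof (rule eq_vec_blockI[of _ n m])
    show "vectorize ?A \<in> carrier_vec (n * m)"
      using vectorize_carrier[OF A(1)] by (simp only: mult.commute)
  qed (simp_all add: kron_vec_carrier[OF u v] vectorize_index[OF A(1)] kron_vec_index[OF u v])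
  moreover have "vectorize ?A\<^sup>T = v \<otimes>\<^sub>v u"
  proof (rule eq_vec_blockI[of _ m n])
    show "vectorize ?A\<^sup>T \<in> carrier_vec (m * n)"
      using vectorize_carrier[OF A(2)] by (simp only: mult.commute)
  qed (simp_all add: kron_vec_carrier[OF v u] vectorize_index[OF A(2)] kron_vec_index[OF v u])
  ultimately show ?thesis using commutation[of m n] A(1) unfolding is_commutation_def by metis
qed

lemma Lambda_mat_carrier: "Lambda_mat b k \<in> carrier_mat (b ^ k) (b ^ k)"
  by (simp add: Lambda_mat_def)

text \<open>
  Commutation matrices exchange two blocks, so the \<open>j\<close>-th summand of \<open>\<Lambda>\<close> rotates a \<open>(k + 1)\<close>-fold
  Kronecker product cyclically. All other factors being equal, the rotations move \<open>y\<close> through all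
  positions.
\<close>

lemma Lambda_mat_kron_index:
  assumes x: "x \<in> carrier_vec b" and y: "y \<in> carrier_vec b" and p: "p < b ^ Suc k"
  shows "(Lambda_mat b (Suc k) *\<^sub>v (kron_vec_power x k \<otimes>\<^sub>v y)) $ p =
    (\<Sum>j<Suc k. ((kron_vec_power x j \<otimes>\<^sub>v y) \<otimes>\<^sub>v kron_vec_power x (k - j)) $ p)"
proof -
  let ?z = "kron_vec_power x k \<otimes>\<^sub>v y"
  let ?K = "\<lambda>j. commutation (b ^ Suc j) (b ^ (k - j))"
  have z: "?z \<in> carrier_vec (b ^ Suc k)"
    using kron_vec_carrier[OF kron_vec_power_carrier[OF x, of k] y] by (simp add: mult.commute)
  have rot: "(\<Sum>s<b ^ Suc k. ?K j $$ (p, s) * ?z $ s) =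
      ((kron_vec_power x j \<otimes>\<^sub>v y) \<otimes>\<^sub>v kron_vec_power x (k - j)) $ p" if j: "j < Suc k" for j
  proof -
    have e: "b ^ Suc j * b ^ (k - j) = b ^ Suc k"
      unfolding power_add[symmetric] using j by simp
    have K: "?K j \<in> carrier_mat (b ^ Suc k) (b ^ Suc k)"
      using commutation[of "b ^ Suc j" "b ^ (k - j)"] unfolding is_commutation_def e by simp
    have "?z = kron_vec_power x (k - j) \<otimes>\<^sub>v (kron_vec_power x j \<otimes>\<^sub>v y)"
      using j kron_vec_power_add[of x "k - j" j] by (simp add: kron_vec_assoc)
    moreover have "kron_vec_power x j \<otimes>\<^sub>v y \<in> carrier_vec (b ^ Suc j)"
      using kron_vec_carrier[OF kron_vec_power_carrier[OF x, of j] y] by (simp add: mult.commute)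
    ultimately have "?K j *\<^sub>v ?z = (kron_vec_power x j \<otimes>\<^sub>v y) \<otimes>\<^sub>v kron_vec_power x (k - j)"
      using commutation_mult_kron[OF kron_vec_power_carrier[OF x, of "k - j"]] by simp
    thus ?thesis using mult_mat_vec_index_sum[OF K z p] by simp
  qed
  have "(Lambda_mat b (Suc k) *\<^sub>v ?z) $ p =
      (\<Sum>s<b ^ Suc k. (\<Sum>j<Suc k. ?K j $$ (p, s)) * ?z $ s)"
    unfolding mult_mat_vec_index_sum[OF Lambda_mat_carrier z p]
    by (intro sum.cong refl)
      (use p in \<open>simp add: Lambda_mat_def sum.atLeast1_atMost_eq
        del: power_Suc sum.lessThan_Suc sum.cl_ivl_Suc\<close>)
  also have "\<dots> = (\<Sum>j<Suc k. \<Sum>s<b ^ Suc k. ?K j $$ (p, s) * ?z $ s)"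
    unfolding sum_distrib_right by (rule sum.swap)
  also have "\<dots> = (\<Sum>j<Suc k. ((kron_vec_power x j \<otimes>\<^sub>v y) \<otimes>\<^sub>v kron_vec_power x (k - j)) $ p)"
    by (intro sum.cong refl rot) simp
  finally show ?thesis .
qed

text \<open>
  \<open>\<Gamma>\<close> is defined by appending factors on the right, which lowers \<open>k\<close> in the new factor only.
  Differentiation produces the leftmost factor first and leaves a problem with \<open>k\<close> lowered by one;
  this is the matching recursion.
\<close>

lemma Gamma_mat_rec:
  "r \<le> k \<Longrightarrow> Gamma_mat b (Suc k) (Suc r) =
    Lambda_mat b (Suc k) * (Gamma_mat b k r \<otimes>\<^sub>m 1\<^sub>m b)"
proof (induction r)
  case 0
  have "Lambda_mat b (Suc k) \<otimes>\<^sub>m 1\<^sub>m 1 = Lambda_mat b (Suc k)" by (rule kron_mat_one_right)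
  thus ?case
    using Lambda_mat_carrier[of b "Suc k"]
    by (auto simp: kron_mat_one_one mult.commute)
next
  case (Suc r)
  let ?L = "Lambda_mat b (k - r)"
  have e: "b ^ (k - r) * b ^ r = b ^ k" using Suc.prems by (simp add: power_add[symmetric])
  have e1: "b ^ k * b = b ^ Suc k" by simp
  note G = Gamma_mat_carrier[of r k b]
  have L: "?L \<otimes>\<^sub>m 1\<^sub>m (b ^ r) \<in> carrier_mat (b ^ k) (b ^ k)"
    using kron_mat_carrier[OF Lambda_mat_carrier[of b "k - r"] one_carrier_mat[of "b ^ r"]]
    by (simp add: e)
  have *: "?L \<otimes>\<^sub>m 1\<^sub>m (b ^ Suc r) = (?L \<otimes>\<^sub>m 1\<^sub>m (b ^ r)) \<otimes>\<^sub>m 1\<^sub>m b"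
    unfolding kron_mat_assoc kron_mat_one_one by (simp add: mult.commute)
  have "Gamma_mat b (Suc k) (Suc (Suc r)) =
      Gamma_mat b (Suc k) (Suc r) * (?L \<otimes>\<^sub>m 1\<^sub>m (b ^ Suc r))"
    by (simp only: Gamma_mat.simps(2)[of b "Suc k" "Suc r"] diff_Suc_Suc)
  also have "\<dots> = (Lambda_mat b (Suc k) * (Gamma_mat b k r \<otimes>\<^sub>m 1\<^sub>m b)) *
      ((?L \<otimes>\<^sub>m 1\<^sub>m (b ^ r)) \<otimes>\<^sub>m 1\<^sub>m b)"
    unfolding * using Suc by simp
  also have "\<dots> = Lambda_mat b (Suc k) * ((Gamma_mat b k r \<otimes>\<^sub>m 1\<^sub>m b) *
      ((?L \<otimes>\<^sub>m 1\<^sub>m (b ^ r)) \<otimes>\<^sub>m 1\<^sub>m b))"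
    using kron_mat_carrier[OF G one_carrier_mat[of b]] kron_mat_carrier[OF L one_carrier_mat[of b]]
      Suc.prems Lambda_mat_carrier[of b "Suc k"]
    by (intro assoc_mult_mat[of _ "b ^ Suc k" "b ^ Suc k"])
      (auto simp: e1[symmetric] simp del: power_Suc)
  also have "(Gamma_mat b k r \<otimes>\<^sub>m 1\<^sub>m b) * ((?L \<otimes>\<^sub>m 1\<^sub>m (b ^ r)) \<otimes>\<^sub>m 1\<^sub>m b) =
      Gamma_mat b k (Suc r) \<otimes>\<^sub>m 1\<^sub>m b"
    using Suc.prems by (subst kron_mat_mult[OF G one_carrier_mat L one_carrier_mat]) auto
  finally show ?case .
qed

section \<open>Polynomial functions\<close>

text \<open>
  All functions to be differentiated are polynomials in the coordinates. Partial derivatives do not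
  leave this class, so that within it existence, linearity and commutation of iterated partial
  derivatives need no bookkeeping of orders of differentiability. The rule \<open>cong\<close> makes membership
  depend on the values on \<open>\<real>\<^sup>d\<close> only.
\<close>

inductive_set polynomial_fun :: "nat \<Rightarrow> (real vec \<Rightarrow> real) set" for d :: nat where
  const: "(\<lambda>_. a) \<in> polynomial_fun d"
| coord: "i < d \<Longrightarrow> (\<lambda>x. x $ i) \<in> polynomial_fun d"
| add: "f \<in> polynomial_fun d \<Longrightarrow> g \<in> polynomial_fun d \<Longrightarrow> (\<lambda>x. f x + g x) \<in> polynomial_fun d"
| mult: "f \<in> polynomial_fun d \<Longrightarrow> g \<in> polynomial_fun d \<Longrightarrow> (\<lambda>x. f x * g x) \<in> polynomial_fun d"
| cong: "f \<in> polynomial_fun d \<Longrightarrow> (\<And>x. x \<in> carrier_vec d \<Longrightarrow> g x = f x) \<Longrightarrow> g \<in> polynomial_fun d"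

lemma polynomial_fun_sum:
  "(\<And>p. p \<in> A \<Longrightarrow> f p \<in> polynomial_fun d) \<Longrightarrow> (\<lambda>x. \<Sum>p\<in>A. a p * f p x) \<in> polynomial_fun d"
proof (induction A rule: infinite_finite_induct)
  case (insert q A)
  have "(\<lambda>x. a q * f q x + (\<Sum>p\<in>A. a p * f p x)) \<in> polynomial_fun d"
    by (rule polynomial_fun.add[OF polynomial_fun.mult[OF polynomial_fun.const]])
      (use insert in auto)
  thus ?case using insert.hyps by simp
qed (auto intro: polynomial_fun.const)

lemma partial_cong:
  assumes "x \<in> carrier_vec d" and "\<And>y. y \<in> carrier_vec d \<Longrightarrow> f y = g y"
  shows "partial i f x = partial i g x"
proof -
  have "f (x + t \<cdot>\<^sub>v unit_vec d i) = g (x + t \<cdot>\<^sub>v unit_vec d i)" for t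
    using assms(1) by (intro assms(2)) auto
  thus ?thesis using assms(1) by (simp add: partial_def)
qed

lemma mixed_partial_cong:
  assumes "x \<in> carrier_vec d" and "\<And>y. y \<in> carrier_vec d \<Longrightarrow> f y = g y"
  shows "mixed_partial is f x = mixed_partial is g x"
  using assms(1) by (induction "is" arbitrary: x) (auto simp: assms(2) intro: partial_cong)

lemma mixed_partial_append: "mixed_partial (is @ js) f = mixed_partial is (mixed_partial js f)"
  by (induction "is") auto

lemma partial_eqI:
  assumes "x \<in> carrier_vec d"
    and "((\<lambda>t. f (x + t \<cdot>\<^sub>v unit_vec d i)) has_field_derivative D) (at 0)"
  shows "partial i f x = D"
  using assms by (auto simp: partial_def dest: DERIV_imp_deriv)

text \<open>
  Membership and existence of the derivative are obtained together: the induction produces some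
  polynomial that is the derivative along the \<open>i\<close>-th axis, which is then identified with \<open>partial i f\<close>.
\<close>

lemma polynomial_fun_partial:
  assumes "f \<in> polynomial_fun d" "i < d"
  shows "partial i f \<in> polynomial_fun d \<and> (\<forall>x\<in>carrier_vec d.
    ((\<lambda>t. f (x + t \<cdot>\<^sub>v unit_vec d i)) has_field_derivative partial i f x) (at 0))"
proof -
  have "\<exists>g \<in> polynomial_fun d. \<forall>x\<in>carrier_vec d.
    ((\<lambda>t. f (x + t \<cdot>\<^sub>v unit_vec d i)) has_field_derivative g x) (at 0)"
    using assms(1)
  proof induction
    case (const a)
    show ?case by (intro bexI[of _ "\<lambda>_. 0"] polynomial_fun.const) auto
  next
    case (coord j)
    have "((\<lambda>t. (x + t \<cdot>\<^sub>v unit_vec d i) $ j) has_field_derivative (if j = i then 1 else 0)) (at 0)"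
      if "x \<in> carrier_vec d" for x
    proof -
      have "(\<lambda>t. (x + t \<cdot>\<^sub>v unit_vec d i) $ j) = (\<lambda>t. x $ j + t * (if j = i then 1 else 0))"
        using coord assms(2) by auto
      thus ?thesis by (auto intro!: derivative_eq_intros)
    qed
    thus ?case by (intro bexI[of _ "\<lambda>_. if j = i then 1 else 0"] polynomial_fun.const) auto
  next
    case (add f g)
    then obtain f' g' where f': "f' \<in> polynomial_fun d" and g': "g' \<in> polynomial_fun d"
      and D: "\<And>x. x\<in>carrier_vec d \<Longrightarrow>
        ((\<lambda>t. f (x + t \<cdot>\<^sub>v unit_vec d i)) has_field_derivative f' x) (at 0)"
        "\<And>x. x\<in>carrier_vec d \<Longrightarrow>
        ((\<lambda>t. g (x + t \<cdot>\<^sub>v unit_vec d i)) has_field_derivative g' x) (at 0)"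
      by blast
    show ?case using DERIV_add[OF D]
      by (intro bexI[of _ "\<lambda>x. f' x + g' x"] ballI polynomial_fun.add f' g')
  next
    case (mult f g)
    then obtain f' g' where f': "f' \<in> polynomial_fun d" and g': "g' \<in> polynomial_fun d"
      and D: "\<And>x. x\<in>carrier_vec d \<Longrightarrow>
        ((\<lambda>t. f (x + t \<cdot>\<^sub>v unit_vec d i)) has_field_derivative f' x) (at 0)"
        "\<And>x. x\<in>carrier_vec d \<Longrightarrow>
        ((\<lambda>t. g (x + t \<cdot>\<^sub>v unit_vec d i)) has_field_derivative g' x) (at 0)"
      by blast
    have "((\<lambda>t. f (x + t \<cdot>\<^sub>v unit_vec d i) * g (x + t \<cdot>\<^sub>v unit_vec d i)) has_field_derivative
        f' x * g x + f x * g' x) (at 0)" if x: "x \<in> carrier_vec d" for x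
    proof -
      have [simp]: "x + 0 \<cdot>\<^sub>v unit_vec d i = x" using x by auto
      show ?thesis using DERIV_mult[OF D[OF x]] by (simp add: mult.commute)
    qed
    moreover have "(\<lambda>x. f' x * g x + f x * g' x) \<in> polynomial_fun d"
      by (intro polynomial_fun.add polynomial_fun.mult f' g' mult.hyps)
    ultimately show ?case by (intro bexI[of _ "\<lambda>x. f' x * g x + f x * g' x"] ballI)
  next
    case (cong f g)
    then obtain f' where f': "f' \<in> polynomial_fun d"
      and D: "\<And>x. x\<in>carrier_vec d \<Longrightarrow>
        ((\<lambda>t. f (x + t \<cdot>\<^sub>v unit_vec d i)) has_field_derivative f' x) (at 0)"
      by blast
    have "(\<lambda>t. g (x + t \<cdot>\<^sub>v unit_vec d i)) = (\<lambda>t. f (x + t \<cdot>\<^sub>v unit_vec d i))"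
      if "x \<in> carrier_vec d" for x
      using that by (intro ext cong.hyps) auto
    thus ?case using f' D by auto
  qed
  then obtain g where g: "g \<in> polynomial_fun d" and D: "\<And>x. x\<in>carrier_vec d \<Longrightarrow>
    ((\<lambda>t. f (x + t \<cdot>\<^sub>v unit_vec d i)) has_field_derivative g x) (at 0)" by blast
  have "partial i f x = g x" if "x \<in> carrier_vec d" for x
    using partial_eqI[OF that D[OF that]] .
  thus ?thesis using polynomial_fun.cong[OF g, of "partial i f"] D by simp
qed

lemmas partial_in_polynomial_fun = polynomial_fun_partial[THEN conjunct1]
lemmas polynomial_fun_has_derivative = polynomial_fun_partial[THEN conjunct2, rule_format]

lemma partial_const: "partial i (\<lambda>_. a) x = 0"
  by (simp add: partial_def)

lemma partial_coord:
  assumes "x \<in> carrier_vec d" "i < d" "j < d"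
  shows "partial i (\<lambda>x. x $ j) x = unit_vec d i $ j"
proof (rule partial_eqI[OF assms(1)])
  have "(\<lambda>t. (x + t \<cdot>\<^sub>v unit_vec d i) $ j) = (\<lambda>t. x $ j + t * unit_vec d i $ j)"
    using assms by auto
  thus "((\<lambda>t. (x + t \<cdot>\<^sub>v unit_vec d i) $ j) has_field_derivative unit_vec d i $ j) (at 0)"
    by (auto intro!: derivative_eq_intros)
qed

lemma partial_add:
  assumes "f \<in> polynomial_fun d" "g \<in> polynomial_fun d" "i < d" "x \<in> carrier_vec d"
  shows "partial i (\<lambda>x. f x + g x) x = partial i f x + partial i g x"
  by (rule partial_eqI[OF assms(4) DERIV_add[OF polynomial_fun_has_derivative[OF assms(1,3,4)]
        polynomial_fun_has_derivative[OF assms(2,3,4)]]])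

lemma partial_mult:
  assumes "f \<in> polynomial_fun d" "g \<in> polynomial_fun d" "i < d" "x \<in> carrier_vec d"
  shows "partial i (\<lambda>x. f x * g x) x = partial i f x * g x + f x * partial i g x"
proof -
  have [simp]: "x + 0 \<cdot>\<^sub>v unit_vec d i = x" using assms(4) by auto
  have "((\<lambda>t. f (x + t \<cdot>\<^sub>v unit_vec d i) * g (x + t \<cdot>\<^sub>v unit_vec d i)) has_field_derivative
      partial i f x * g x + f x * partial i g x) (at 0)"
    using DERIV_mult[OF polynomial_fun_has_derivative[OF assms(1,3,4)]
        polynomial_fun_has_derivative[OF assms(2,3,4)]]
    by (simp add: mult.commute)
  thus ?thesis by (rule partial_eqI[OF assms(4)])
qed

text \<open>
  An algebraic substitute for the theorem of Schwarz: coordinates have constant partial derivatives, and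
  for a product the two second derivatives agree by the product rule and the induction hypotheses.
\<close>

lemma partial_commute:
  assumes "f \<in> polynomial_fun d" "i < d" "j < d" "x \<in> carrier_vec d"
  shows "partial i (partial j f) x = partial j (partial i f) x"
  using assms(1,4)
proof (induction arbitrary: x)
  case (const a)
  show ?case by (simp add: partial_def)
next
  case (coord l)
  have *: "partial i' (partial j' (\<lambda>x. x $ l)) x = 0" if "i' < d" "j' < d" for i' j'
    using partial_cong[OF coord(2), of "partial j' (\<lambda>x. x $ l)" "\<lambda>_. unit_vec d j' $ l" i']
      partial_coord that coord(1) by (simp add: partial_const)
  show ?case using assms(2,3) by (simp add: *)
next
  case (add f g)
  have *: "partial i' (partial j' (\<lambda>x. f x + g x)) x =
      partial i' (partial j' f) x + partial i' (partial j' g) x" if "i' < d" "j' < d" for i' j'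
  proof -
    have "partial i' (partial j' (\<lambda>x. f x + g x)) x =
        partial i' (\<lambda>x. partial j' f x + partial j' g x) x"
      by (rule partial_cong[OF add.prems]) (rule partial_add[OF add.hyps that(2)])
    also have "\<dots> = partial i' (partial j' f) x + partial i' (partial j' g) x"
      using add that by (intro partial_add[of "partial j' f" d "partial j' g"] partial_in_polynomial_fun)
    finally show ?thesis .
  qed
  show ?case using assms(2,3) add by (simp add: *)
next
  case (mult f g)
  have *: "partial i' (partial j' (\<lambda>x. f x * g x)) x =
      (partial i' (partial j' f) x * g x + partial j' f x * partial i' g x) +
      (partial i' f x * partial j' g x + f x * partial i' (partial j' g) x)"
    if ij: "i' < d" "j' < d" for i' j'
  proof -
    note P = mult.hyps partial_in_polynomial_fun[OF mult.hyps(1) ij(2)]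
      partial_in_polynomial_fun[OF mult.hyps(2) ij(2)]
    have "partial i' (partial j' (\<lambda>x. f x * g x)) x =
        partial i' (\<lambda>x. partial j' f x * g x + f x * partial j' g x) x"
      by (rule partial_cong[OF mult.prems]) (rule partial_mult[OF mult.hyps that(2)])
    also have "\<dots> = partial i' (\<lambda>x. partial j' f x * g x) x + partial i' (\<lambda>x. f x * partial j' g x) x"
      by (rule partial_add[OF polynomial_fun.mult[OF P(3,2)] polynomial_fun.mult[OF P(1,4)]
            ij(1) mult.prems])
    also have "\<dots> = (partial i' (partial j' f) x * g x + partial j' f x * partial i' g x) +
      (partial i' f x * partial j' g x + f x * partial i' (partial j' g) x)"
      by (simp only: partial_mult[OF P(3,2) ij(1) mult.prems] partial_mult[OF P(1,4) ij(1) mult.prems])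
    finally show ?thesis .
  qed
  show ?case using assms(2,3) mult by (simp add: *)
next
  case (cong f g)
  have *: "partial i' (partial j' g) x = partial i' (partial j' f) x" for i' j'
    by (intro partial_cong[OF cong.prems] partial_cong cong.hyps(2))
  show ?case using cong by (simp add: *)
qed

lemma mixed_partial_in_polynomial_fun:
  "f \<in> polynomial_fun d \<Longrightarrow> set is \<subseteq> {..<d} \<Longrightarrow> mixed_partial is f \<in> polynomial_fun d"
  by (induction "is") (auto intro: partial_in_polynomial_fun)

lemma polynomial_fun_has_partials: "f \<in> polynomial_fun d \<Longrightarrow> has_partials d r f"
  unfolding has_partials_def field_differentiable_def
  using polynomial_fun_has_derivative mixed_partial_in_polynomial_fun by blast

lemma partial_sum:
  assumes "\<And>p. p \<in> A \<Longrightarrow> f p \<in> polynomial_fun d" "i < d" "x \<in> carrier_vec d"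
  shows "partial i (\<lambda>x. \<Sum>p\<in>A. a p * f p x) x = (\<Sum>p\<in>A. a p * partial i (f p) x)"
  by (rule partial_eqI[OF assms(3) DERIV_sum[OF DERIV_cmult[OF
          polynomial_fun_has_derivative[OF assms(1) assms(2,3)]]]])

lemma mixed_partial_sum:
  assumes "\<And>p. p \<in> A \<Longrightarrow> f p \<in> polynomial_fun d" "set is \<subseteq> {..<d}" "x \<in> carrier_vec d"
  shows "mixed_partial is (\<lambda>x. \<Sum>p\<in>A. a p * f p x) x = (\<Sum>p\<in>A. a p * mixed_partial is (f p) x)"
  using assms(2,3)
proof (induction "is" arbitrary: x)
  case (Cons i "is")
  have "mixed_partial (i # is) (\<lambda>x. \<Sum>p\<in>A. a p * f p x) x =
      partial i (\<lambda>x. \<Sum>p\<in>A. a p * mixed_partial is (f p) x) x"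
    using Cons by (auto intro: partial_cong)
  also have "\<dots> = (\<Sum>p\<in>A. a p * mixed_partial (i # is) (f p) x)"
    using Cons.prems assms(1)
    by (subst partial_sum[of _ _ d]) (auto intro: mixed_partial_in_polynomial_fun)
  finally show ?case .
qed simp

lemma mixed_partial_move_to_front:
  assumes "f \<in> polynomial_fun d" "set (as @ i # bs) \<subseteq> {..<d}" "x \<in> carrier_vec d"
  shows "mixed_partial (as @ i # bs) f x = mixed_partial (i # as @ bs) f x"
  using assms(2,3)
proof (induction as arbitrary: x)
  case (Cons a as)
  have "mixed_partial ((a # as) @ i # bs) f x = partial a (mixed_partial (i # as @ bs) f) x"
    using Cons by (auto intro: partial_cong)
  also have "\<dots> = partial a (partial i (mixed_partial (as @ bs) f)) x" by simp
  also have "\<dots> = partial i (partial a (mixed_partial (as @ bs) f)) x"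
    using Cons.prems assms(1)
    by (intro partial_commute[of _ d] mixed_partial_in_polynomial_fun) auto
  finally show ?case by simp
qed simp

text \<open>
  A rearrangement is undone one index at a time, by moving the index that must come first through the
  others.
\<close>

lemma mixed_partial_symmetric:
  assumes "f \<in> polynomial_fun d" "mset is = mset js" "set is \<subseteq> {..<d}" "x \<in> carrier_vec d"
  shows "mixed_partial is f x = mixed_partial js f x"
  using assms(2-)
proof (induction "is" arbitrary: js x)
  case (Cons i "is")
  have "i \<in> set js" using Cons.prems(1) by (metis list.set_intros(1) mset_eq_setD)
  then obtain as bs where js: "js = as @ i # bs" by (meson split_list)
  hence m: "mset is = mset (as @ bs)" using Cons.prems(1) by simp
  have s: "set js \<subseteq> {..<d}" using Cons.prems(1,2) mset_eq_setD by blast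
  have "mixed_partial (i # is) f x = mixed_partial (i # as @ bs) f x"
    unfolding mixed_partial.simps
    by (rule partial_cong[OF Cons.prems(3)]) (use Cons.IH[OF m] Cons.prems(2) in auto)
  thus ?case using mixed_partial_move_to_front[OF assms(1) s[unfolded js] Cons.prems(3)] js
    by simp
qed simp

section \<open>Derivatives of Kronecker powers\<close>

lemma kron_vec_power_index:
  assumes "x \<in> carrier_vec b" "s < b" "t < b ^ k"
  shows "kron_vec_power x (Suc k) $ (s * b ^ k + t) = x $ s * kron_vec_power x k $ t"
  unfolding kron_vec_power_Suc
  using kron_vec_index[OF assms(1) kron_vec_power_carrier[OF assms(1)] assms(2,3)] .

lemma kron_vec_power_polynomial:
  "p < b ^ k \<Longrightarrow> (\<lambda>y. kron_vec_power y k $ p) \<in> polynomial_fun b"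
proof (induction k arbitrary: p)
  case 0
  thus ?case by (auto simp: kron_vec_power_def intro: polynomial_fun.const)
next
  case (Suc k)
  then obtain s t where st: "s < b" "t < b ^ k" and p: "p = s * b ^ k + t"
    by (metis block_indexE power_Suc)
  show ?case
    by (rule polynomial_fun.cong[OF polynomial_fun.mult[OF polynomial_fun.coord[OF st(1)]
          Suc.IH[OF st(2)]]])
      (simp add: p kron_vec_power_index st)
qed

text \<open>
  The product rule for \<open>x \<otimes> x\<^sup>\<otimes>\<^sup>k\<close>: differentiating the first factor gives the insertion of \<open>e\<^sub>i\<close> at the
  front, and the other insertions are those into \<open>x\<^sup>\<otimes>\<^sup>k\<close>, shifted by one place.
\<close>

lemma partial_kron_vec_power:
  assumes x: "x \<in> carrier_vec b" and i: "i < b" and p: "p < b ^ k"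
  shows "partial i (\<lambda>y. kron_vec_power y k $ p) x =
    (\<Sum>j<k. ((kron_vec_power x j \<otimes>\<^sub>v unit_vec b i) \<otimes>\<^sub>v kron_vec_power x (k - Suc j)) $ p)"
  using p
proof (induction k arbitrary: p)
  case 0
  thus ?case by (simp add: kron_vec_power_def partial_const)
next
  case (Suc k)
  let ?e = "unit_vec b i :: real vec"
  let ?ins = "\<lambda>k j. (kron_vec_power x j \<otimes>\<^sub>v ?e) \<otimes>\<^sub>v kron_vec_power x (k - Suc j)"
  have ins: "?ins k j \<in> carrier_vec (b ^ k)" if "j < k" for j
  proof -
    have "b ^ j * b * b ^ (k - Suc j) = b ^ k"
      using that by (simp only: power_Suc2[symmetric] power_add[symmetric]) simp
    thus ?thesis
      using kron_vec_carrier[OF kron_vec_carrier[OF kron_vec_power_carrier[OF x, of j]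
            unit_vec_carrier[of b i]] kron_vec_power_carrier[OF x, of "k - Suc j"]] by simp
  qed
  obtain s t where st: "s < b" "t < b ^ k" and p: "p = s * b ^ k + t"
    using Suc.prems by (metis block_indexE power_Suc)
  have "partial i (\<lambda>y. kron_vec_power y (Suc k) $ p) x =
      partial i (\<lambda>y. y $ s * kron_vec_power y k $ t) x"
    by (rule partial_cong[OF x]) (simp add: p kron_vec_power_index st)
  also have "\<dots> = ?e $ s * kron_vec_power x k $ t +
      x $ s * (\<Sum>j<k. ?ins k j $ t)"
    unfolding partial_mult[OF polynomial_fun.coord[OF st(1)] kron_vec_power_polynomial[OF st(2)] i x]
      partial_coord[OF x i st(1)] Suc.IH[OF st(2)] ..
  also have "?e $ s * kron_vec_power x k $ t = ?ins (Suc k) 0 $ p"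
    using kron_vec_index[OF unit_vec_carrier[of b i] kron_vec_power_carrier[OF x] st]
      kron_list_append[of "[]" "[?e]"]
    by (simp add: kron_vec_power_def p kron_list_single del: kron_list.simps(2))
  also have "x $ s * (\<Sum>j<k. ?ins k j $ t) = (\<Sum>j<k. ?ins (Suc k) (Suc j) $ p)"
    unfolding sum_distrib_left
    by (intro sum.cong refl)
      (simp add: kron_vec_power_Suc kron_vec_assoc[of x] p kron_vec_index[OF x ins st])
  finally show ?case by (simp add: sum.lessThan_Suc_shift del: sum.lessThan_Suc)
qed

text \<open>
  The identity \<open>\<partial>\<^sub>i x\<^bsup>\<otimes>(k+1)\<^esup> = \<Lambda> (x\<^sup>\<otimes>\<^sup>k \<otimes> e\<^sub>i)\<close>, expanded as a linear combination of the entries of \<open>x\<^sup>\<otimes>\<^sup>k\<close>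
  with constant coefficients, so that further partial derivatives can be taken term by term.
\<close>

lemma partial_kron_vec_power_Lambda:
  assumes x: "x \<in> carrier_vec b" and i: "i < b" and p: "p < b ^ Suc k"
  shows "partial i (\<lambda>y. kron_vec_power y (Suc k) $ p) x =
    (\<Sum>s<b ^ k. \<Sum>t<b. Lambda_mat b (Suc k) $$ (p, s * b + t) * unit_vec b i $ t *
      kron_vec_power x k $ s)"
proof -
  have z: "kron_vec_power x k \<otimes>\<^sub>v unit_vec b i \<in> carrier_vec (b ^ k * b)"
    by (rule kron_vec_carrier[OF kron_vec_power_carrier[OF x] unit_vec_carrier])
  have L: "Lambda_mat b (Suc k) \<in> carrier_mat (b ^ k * b) (b ^ k * b)"
    using Lambda_mat_carrier[of b "Suc k"] by (simp add: mult.commute)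
  have "partial i (\<lambda>y. kron_vec_power y (Suc k) $ p) x =
      (Lambda_mat b (Suc k) *\<^sub>v (kron_vec_power x k \<otimes>\<^sub>v unit_vec b i)) $ p"
    unfolding partial_kron_vec_power[OF x i p] Lambda_mat_kron_index[OF x unit_vec_carrier p]
    by simp
  also have "\<dots> = (\<Sum>s<b ^ k. \<Sum>t<b. Lambda_mat b (Suc k) $$ (p, s * b + t) *
      (kron_vec_power x k \<otimes>\<^sub>v unit_vec b i) $ (s * b + t))"
    unfolding mult_mat_vec_index_sum[OF L z p[unfolded power_Suc2]] sum_block_index ..
  also have "\<dots> = (\<Sum>s<b ^ k. \<Sum>t<b. Lambda_mat b (Suc k) $$ (p, s * b + t) * unit_vec b i $ t *
      kron_vec_power x k $ s)"
    by (intro sum.cong refl)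
      (simp add: kron_vec_index[OF kron_vec_power_carrier[OF x] unit_vec_carrier] del: index_unit_vec)
  finally show ?thesis .
qed

text \<open>
  The core of the proof. The partial derivative that is taken first belongs to the last index, hence
  the induction peels indices off the end of the list: this derivative contributes \<open>\<Lambda>\<close> and the
  last tensor factor, and the induction hypothesis for \<open>k - 1\<close> handles the rest.
\<close>

lemma mixed_partial_kron_vec_power:
  assumes x: "x \<in> carrier_vec b" and "set is \<subseteq> {..<b}" "length is \<le> k" "p < b ^ k"
  shows "mixed_partial is (\<lambda>y. kron_vec_power y k $ p) x =
    (Gamma_mat b k (length is) *\<^sub>v
      (kron_vec_power x (k - length is) \<otimes>\<^sub>v kron_list (map (unit_vec b) is))) $ p"
  using assms(2-)
proof (induction "is" arbitrary: k p rule: rev_induct)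
  case Nil
  have "kron_vec_power x k \<otimes>\<^sub>v kron_list [] = kron_vec_power x k"
    using kron_list_append[of "replicate k x" "[]"] by (simp add: kron_vec_power_def)
  thus ?case using kron_vec_power_carrier[OF x, of k] by simp
next
  case (snoc i "is")
  define r where "r = length is"
  obtain k' where k: "k = Suc k'" using snoc.prems by (cases k) auto
  have r: "r \<le> k'" and "is": "set is \<subseteq> {..<b}" and i: "i < b"
    using snoc.prems by (auto simp: r_def k)
  have p: "p < b ^ Suc k'" using snoc.prems(3) by (simp only: k)
  let ?z = "kron_vec_power x (k' - r) \<otimes>\<^sub>v kron_list (map (unit_vec b) is)"
  let ?e = "unit_vec b i :: real vec"
  let ?G = "Gamma_mat b k' r"
  let ?L = "Lambda_mat b (Suc k')"
  have z: "?z \<in> carrier_vec (b ^ k')"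
  proof -
    have "kron_list (map (unit_vec b) is) \<in> carrier_vec (b ^ r)"
      unfolding r_def using kron_list_carrier[of "map (unit_vec b) is" b]
      by (simp add: image_subset_iff)
    from kron_vec_carrier[OF kron_vec_power_carrier[OF x, of "k' - r"] this]
    show ?thesis using r by (simp add: power_add[symmetric])
  qed
  note G = Gamma_mat_carrier[OF r, of b]
  have Gz: "?G *\<^sub>v ?z \<in> carrier_vec (b ^ k')" using G z by simp
  have L: "?L \<in> carrier_mat (b ^ k' * b) (b ^ k' * b)"
    using Lambda_mat_carrier[of b "Suc k'"] by (simp add: mult.commute)
  have GI: "?G \<otimes>\<^sub>m 1\<^sub>m b \<in> carrier_mat (b ^ k' * b) (b ^ k' * b)"
    by (rule kron_mat_carrier[OF G one_carrier_mat])
  have ze: "?z \<otimes>\<^sub>v ?e \<in> carrier_vec (b ^ k' * b)" by (rule kron_vec_carrier[OF z unit_vec_carrier])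
  have IH: "mixed_partial is (\<lambda>y. kron_vec_power y k' $ s) x = (?G *\<^sub>v ?z) $ s"
    if "s < b ^ k'" for s
    using snoc.IH[OF "is" _ that] r by (simp add: r_def)
  have "mixed_partial (is @ [i]) (\<lambda>y. kron_vec_power y k $ p) x =
      mixed_partial is (partial i (\<lambda>y. kron_vec_power y (Suc k') $ p)) x"
    by (simp add: mixed_partial_append k)
  also have "\<dots> = mixed_partial is (\<lambda>y. \<Sum>s<b ^ k'.
      (\<Sum>t<b. ?L $$ (p, s * b + t) * ?e $ t) * kron_vec_power y k' $ s) x"
    by (rule mixed_partial_cong[OF x])
      (simp add: partial_kron_vec_power_Lambda[OF _ i p] sum_distrib_right del: index_unit_vec)
  also have "\<dots> = (\<Sum>s<b ^ k'. (\<Sum>t<b. ?L $$ (p, s * b + t) * ?e $ t) * (?G *\<^sub>v ?z) $ s)"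
    by (subst mixed_partial_sum[OF _ "is" x])
      (auto intro: kron_vec_power_polynomial simp: IH simp del: index_mult_mat_vec)
  also have "\<dots> = (\<Sum>s<b ^ k'. \<Sum>t<b. ?L $$ (p, s * b + t) * ((?G *\<^sub>v ?z) \<otimes>\<^sub>v ?e) $ (s * b + t))"
    unfolding sum_distrib_right
    by (intro sum.cong refl)
      (simp add: kron_vec_index[OF Gz unit_vec_carrier] del: index_unit_vec index_mult_mat_vec)
  also have "\<dots> = (?L *\<^sub>v ((?G *\<^sub>v ?z) \<otimes>\<^sub>v ?e)) $ p"
    unfolding mult_mat_vec_index_sum[OF L kron_vec_carrier[OF Gz unit_vec_carrier]
        p[unfolded power_Suc2]] sum_block_index ..
  also have "(?G *\<^sub>v ?z) \<otimes>\<^sub>v ?e = (?G \<otimes>\<^sub>m 1\<^sub>m b) *\<^sub>v (?z \<otimes>\<^sub>v ?e)"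
    using kron_mat_mult_vec[OF G one_carrier_mat z unit_vec_carrier[of b i]] by simp
  also have "?L *\<^sub>v \<dots> = (?L * (?G \<otimes>\<^sub>m 1\<^sub>m b)) *\<^sub>v (?z \<otimes>\<^sub>v ?e)"
    by (rule assoc_mult_mat_vec[OF L GI ze, symmetric])
  also have "?L * (?G \<otimes>\<^sub>m 1\<^sub>m b) = Gamma_mat b k (length (is @ [i]))"
    using Gamma_mat_rec[OF r, of b] by (simp add: k r_def)
  also have "?z \<otimes>\<^sub>v ?e = kron_vec_power x (k - length (is @ [i])) \<otimes>\<^sub>v
      kron_list (map (unit_vec b) (is @ [i]))"
    by (simp add: k r_def kron_vec_assoc kron_list_append kron_list_single del: kron_list.simps(2))
  finally show ?case .
qed

section \<open>The symmetrizer\<close>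

lemma symmetrizer_carrier: "0 < d \<Longrightarrow> symmetrizer d r \<in> carrier_mat (d ^ r) (d ^ r)"
  using symmetrizer unfolding is_symmetrizer_def by blast

text \<open>
  The defining property in coordinates; with \<open>kron_list vs\<close> a vector of ones or a unit vector it yields the
  row sums and the entries of the symmetrizer.
\<close>

lemma symmetrizer_mult_kron_list_index:
  assumes d: "0 < d" and len: "length vs = r" and vs: "set vs \<subseteq> carrier_vec d" and q: "q < d ^ r"
  shows "fact r * (\<Sum>m<d ^ r. symmetrizer d r $$ (q, m) * kron_list vs $ m) =
    (\<Sum>\<sigma> | \<sigma> permutes {..<r}. \<Prod>j<r. vs ! \<sigma> j $ digit d r q j)"
proof -
  let ?S = "symmetrizer d r"
  let ?perm = "\<lambda>\<sigma>. map (\<lambda>j. vs ! \<sigma> j) [0..<r]"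
  note S = symmetrizer_carrier[OF d, of r]
  have l: "kron_list vs \<in> carrier_vec (d ^ r)" using kron_list_carrier[OF vs] len by simp
  have setp: "set (?perm \<sigma>) \<subseteq> carrier_vec d" if "\<sigma> permutes {..<r}" for \<sigma>
  proof -
    have "\<sigma> j < r" if "j < r" for j
      using permutes_in_image[OF \<open>\<sigma> permutes {..<r}\<close>, of j] that by simp
    thus ?thesis using vs len by auto
  qed
  have "fact r * (\<Sum>m<d ^ r. ?S $$ (q, m) * kron_list vs $ m) =
      (fact r \<cdot>\<^sub>v (?S *\<^sub>v kron_list vs)) $ q"
    using q S mult_mat_vec_index_sum[OF S l q] by (simp del: index_mult_mat_vec)
  also have "\<dots> = finsum_vec TYPE(real) (d ^ r) (\<lambda>\<sigma>. kron_list (?perm \<sigma>)) {\<sigma>. \<sigma> permutes {..<r}} $ q"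
    using symmetrizer[OF d, of r] len vs unfolding is_symmetrizer_def by simp
  also have "\<dots> = (\<Sum>\<sigma> | \<sigma> permutes {..<r}. kron_list (?perm \<sigma>) $ q)"
    using q kron_list_carrier[OF setp]
    by (intro index_finsum_vec) (auto simp: finite_permutations)
  also have "\<dots> = (\<Sum>\<sigma> | \<sigma> permutes {..<r}. \<Prod>j<r. vs ! \<sigma> j $ digit d r q j)"
    by (intro sum.cong refl) (use kron_list_index[OF setp] q in simp)
  finally show ?thesis .
qed

text \<open>
  The vector of ones is the Kronecker power of a vector of ones, and permuting equal factors does not
  change it.
\<close>

lemma symmetrizer_row_sum:
  assumes d: "0 < d" and q: "q < d ^ r"
  shows "(\<Sum>m<d ^ r. symmetrizer d r $$ (q, m)) = 1"
proof -
  let ?vs = "replicate r (vec d (\<lambda>_. 1)) :: real vec list"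
  have vs: "set ?vs \<subseteq> carrier_vec d" by (auto simp: set_replicate_conv_if)
  have one: "kron_list ?vs $ m = 1" if "m < d ^ r" for m
    using kron_list_index[OF vs, of m] that digit_less[OF d] by simp
  have "fact r * (\<Sum>m<d ^ r. symmetrizer d r $$ (q, m)) =
      fact r * (\<Sum>m<d ^ r. symmetrizer d r $$ (q, m) * kron_list ?vs $ m)"
    by (simp add: one)
  also have "\<dots> = (\<Sum>\<sigma> | \<sigma> permutes {..<r}. \<Prod>j<r. ?vs ! \<sigma> j $ digit d r q j)"
    by (rule symmetrizer_mult_kron_list_index[OF d _ vs q]) simp
  also have "\<dots> = (\<Sum>\<sigma> | \<sigma> permutes {..<r}. 1)"
  proof (intro sum.cong prod.neutral refl ballI)
    fix \<sigma> j assume "\<sigma> \<in> {\<sigma>. \<sigma> permutes {..<r}}" "j \<in> {..<r}"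
    hence "\<sigma> j < r" using permutes_in_image[of \<sigma> "{..<r}" j] by simp
    thus "?vs ! \<sigma> j $ digit d r q j = 1" using digit_less[OF d] by simp
  qed
  also have "\<dots> = fact r" by (simp add: card_permutations)
  finally show ?thesis by simp
qed

text \<open>
  The column of \<open>m\<close> is the image of a unit vector, that is, an average of unit vectors whose
  multi-indices are rearrangements of that of \<open>m\<close>.
\<close>

lemma symmetrizer_nonzero_imp_mset_eq:
  assumes d: "0 < d" and q: "q < d ^ r" and m: "m < d ^ r"
    and nz: "symmetrizer d r $$ (q, m) \<noteq> 0"
  shows "mset (multi_index d r q) = mset (multi_index d r m)"
proof -
  let ?vs = "map (\<lambda>j. unit_vec d (digit d r m j)) [0..<r] :: real vec list"
  have "fact r * (\<Sum>s<d ^ r. symmetrizer d r $$ (q, s) * kron_list ?vs $ s) =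
      fact r * symmetrizer d r $$ (q, m)"
    unfolding kron_list_unit_vec[OF d m] using m by (simp add: if_distrib[of "\<lambda>x. _ * x"] cong: if_cong)
  hence "(\<Sum>\<sigma> | \<sigma> permutes {..<r}. \<Prod>j<r. ?vs ! \<sigma> j $ digit d r q j) \<noteq> 0"
    using symmetrizer_mult_kron_list_index[OF d _ _ q, of ?vs] nz by fastforce
  then obtain \<sigma> where \<sigma>: "\<sigma> permutes {..<r}"
    and "(\<Prod>j<r. ?vs ! \<sigma> j $ digit d r q j) \<noteq> 0"
    by (auto elim: sum.not_neutral_contains_not_neutral)
  hence "?vs ! \<sigma> j $ digit d r q j \<noteq> 0" if "j < r" for j using that by auto
  moreover have lt: "\<sigma> j < r" if "j < r" for j using permutes_in_image[OF \<sigma>, of j] that by simp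
  ultimately have "digit d r q j = digit d r m (\<sigma> j)" if "j < r" for j
    using that digit_less[OF d] by (fastforce split: if_splits)
  hence "multi_index d r q = permute_list \<sigma> (multi_index d r m)"
    using lt by (auto simp: multi_index_def permute_list_def)
  thus ?thesis using mset_permute_list[of \<sigma> "multi_index d r m"] \<sigma> by (simp add: multi_index_def)
qed

text \<open>
  In the row of \<open>q\<close> only rearrangements of \<open>q\<close> carry weight, \<open>g\<close> is constant there, and the weights add
  up to one.
\<close>

lemma symmetrizer_fixes_symmetric:
  assumes d: "0 < d" and q: "q < d ^ r"
    and g: "\<And>m. m < d ^ r \<Longrightarrow> mset (multi_index d r q) = mset (multi_index d r m) \<Longrightarrow> g m = g q"
  shows "(\<Sum>m<d ^ r. symmetrizer d r $$ (q, m) * g m) = g q"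
proof -
  have "(\<Sum>m<d ^ r. symmetrizer d r $$ (q, m) * g m) = (\<Sum>m<d ^ r. symmetrizer d r $$ (q, m) * g q)"
    using symmetrizer_nonzero_imp_mset_eq[OF d q] g by (intro sum.cong refl) fastforce
  thus ?thesis using symmetrizer_row_sum[OF d q] by (simp add: sum_distrib_right[symmetric])
qed

section \<open>Linear images of Kronecker powers\<close>

text \<open>
  The effect of \<open>vec I = (\<Sum>t. e\<^sub>t \<otimes> e\<^sub>t)\<close>: it hands the same index \<open>t\<close> to both tensor factors of the matrix.
\<close>

lemma kron_mat_mult_kron_vectorize_one:
  assumes N: "N \<in> carrier_mat a (c * n)" and S: "S \<in> carrier_mat p n" and z: "z \<in> carrier_vec c"
    and l: "l < a" and q: "q < p"
  shows "((N \<otimes>\<^sub>m S) *\<^sub>v (z \<otimes>\<^sub>v vectorize (1\<^sub>m n))) $ (l * p + q) =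
    (\<Sum>t<n. S $$ (q, t) * (N *\<^sub>v (z \<otimes>\<^sub>v unit_vec n t)) $ l)"
proof -
  have V: "vectorize (1\<^sub>m n) \<in> carrier_vec (n * n)" by (rule vectorize_carrier[OF one_carrier_mat])
  have zV: "z \<otimes>\<^sub>v vectorize (1\<^sub>m n) \<in> carrier_vec (c * n * n)"
    using kron_vec_carrier[OF z V] by (simp add: mult.assoc)
  \<comment> \<open>Entry \<open>w * n + t\<close> of \<open>vec I\<close> is entry \<open>w\<close> of \<open>e\<^sub>t\<close>.\<close>
  have entry: "(z \<otimes>\<^sub>v vectorize (1\<^sub>m n)) $ (u * n + t) = (z \<otimes>\<^sub>v unit_vec n t) $ u"
    if u: "u < c * n" and t: "t < n" for u t
  proof -
    obtain i w where iw: "i < c" "w < n" and u: "u = i * n + w" using u by (rule block_indexE)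
    have "(z \<otimes>\<^sub>v vectorize (1\<^sub>m n)) $ (i * (n * n) + (w * n + t)) = z $ i * 1\<^sub>m n $$ (t, w)"
      using kron_vec_index[OF z V iw(1) block_index_less[OF iw(2) t]]
        vectorize_index[OF one_carrier_mat t iw(2)] by simp
    moreover have "(z \<otimes>\<^sub>v unit_vec n t) $ u = z $ i * 1\<^sub>m n $$ (t, w)"
      using iw t by (simp add: u kron_vec_index[OF z unit_vec_carrier iw])
    ultimately show ?thesis by (simp add: u algebra_simps)
  qed
  have "((N \<otimes>\<^sub>m S) *\<^sub>v (z \<otimes>\<^sub>v vectorize (1\<^sub>m n))) $ (l * p + q) =
      (\<Sum>u<c * n. \<Sum>t<n. (N $$ (l, u) * S $$ (q, t)) * (z \<otimes>\<^sub>v unit_vec n t) $ u)"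
    unfolding mult_mat_vec_index_sum[OF kron_mat_carrier[OF N S] zV block_index_less[OF l q]]
      sum_block_index[where m = "c * n" and n = n]
    by (intro sum.cong refl) (simp add: entry kron_mat_index[OF N S l q])
  also have "\<dots> = (\<Sum>t<n. \<Sum>u<c * n. (N $$ (l, u) * S $$ (q, t)) * (z \<otimes>\<^sub>v unit_vec n t) $ u)"
    by (rule sum.swap)
  also have "\<dots> = (\<Sum>t<n. S $$ (q, t) * (N *\<^sub>v (z \<otimes>\<^sub>v unit_vec n t)) $ l)"
    unfolding mult_mat_vec_index_sum[OF N kron_vec_carrier[OF z unit_vec_carrier] l] sum_distrib_left
    by (intro sum.cong refl) simp
  finally show ?thesis .
qed

lemma mult_kron_power_polynomial:
  assumes M: "M \<in> carrier_mat a (b ^ k)"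
    and f: "\<And>y. y \<in> carrier_vec b \<Longrightarrow> f y = M *\<^sub>v kron_vec_power y k" and l: "l < a"
  shows "(\<lambda>y. f y $ l) \<in> polynomial_fun b"
proof (rule polynomial_fun.cong)
  show "(\<lambda>y. \<Sum>p<b ^ k. M $$ (l, p) * kron_vec_power y k $ p) \<in> polynomial_fun b"
    by (intro polynomial_fun_sum kron_vec_power_polynomial) simp
  show "f y $ l = (\<Sum>p<b ^ k. M $$ (l, p) * kron_vec_power y k $ p)" if "y \<in> carrier_vec b" for y
    unfolding f[OF that] by (rule mult_mat_vec_index_sum[OF M kron_vec_power_carrier[OF that] l])
qed

lemma mult_kron_power_has_partials_vec:
  assumes "M \<in> carrier_mat a (b ^ k)"
    and "\<And>y. y \<in> carrier_vec b \<Longrightarrow> f y = M *\<^sub>v kron_vec_power y k"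
  shows "has_partials_vec b a r f"
  unfolding has_partials_vec_def
  using assms by (auto intro!: polynomial_fun_has_partials
      mult_kron_power_polynomial[of M a b k f] mult_mat_vec_carrier kron_vec_power_carrier)

lemma mixed_partial_mult_kron_power:
  assumes M: "M \<in> carrier_mat a (b ^ k)"
    and f: "\<And>y. y \<in> carrier_vec b \<Longrightarrow> f y = M *\<^sub>v kron_vec_power y k" and l: "l < a"
    and b: "0 < b" and r: "r \<le> k" and x: "x \<in> carrier_vec b" and q: "q < b ^ r"
  shows "mixed_partial (multi_index b r q) (\<lambda>y. f y $ l) x =
    ((M * Gamma_mat b k r) *\<^sub>v (kron_vec_power x (k - r) \<otimes>\<^sub>v unit_vec (b ^ r) q)) $ l"
proof -
  let ?i = "multi_index b r q"
  let ?w = "kron_vec_power x (k - r) \<otimes>\<^sub>v unit_vec (b ^ r) q"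
  note G = Gamma_mat_carrier[OF r, of b]
  have i: "set ?i \<subseteq> {..<b}" "length ?i = r" using digit_less[OF b] by (auto simp: multi_index_def)
  have e: "kron_list (map (unit_vec b) ?i) = unit_vec (b ^ r) q"
    using kron_list_unit_vec[OF b q] by (simp add: multi_index_def o_def)
  have w: "?w \<in> carrier_vec (b ^ k)"
    using kron_vec_carrier[OF kron_vec_power_carrier[OF x, of "k - r"] unit_vec_carrier[of "b ^ r" q]] r
    by (simp add: power_add[symmetric])
  have "mixed_partial ?i (\<lambda>y. f y $ l) x =
      mixed_partial ?i (\<lambda>y. \<Sum>p<b ^ k. M $$ (l, p) * kron_vec_power y k $ p) x"
    by (rule mixed_partial_cong[OF x])
      (simp only: f mult_mat_vec_index_sum[OF M kron_vec_power_carrier l])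
  also have "\<dots> = (\<Sum>p<b ^ k. M $$ (l, p) * (Gamma_mat b k r *\<^sub>v ?w) $ p)"
    by (subst mixed_partial_sum[OF _ i(1) x])
      (auto intro: kron_vec_power_polynomial
        simp: mixed_partial_kron_vec_power[OF x i(1)] i(2) r e simp del: index_mult_mat_vec)
  also have "\<dots> = (M *\<^sub>v (Gamma_mat b k r *\<^sub>v ?w)) $ l"
    by (rule mult_mat_vec_index_sum[OF M mult_mat_vec_carrier[OF G w] l, symmetric])
  also have "M *\<^sub>v (Gamma_mat b k r *\<^sub>v ?w) = (M * Gamma_mat b k r) *\<^sub>v ?w"
    by (rule assoc_mult_mat_vec[OF M G w, symmetric])
  finally show ?thesis .
qed

text \<open>
  Entry \<open>(l, q)\<close> of the right-hand side is the average, with the weights of the symmetrizer, of the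
  mixed partials of the \<open>l\<close>-th component; as these are symmetric, only the one of \<open>q\<close> is left.
\<close>

lemma tensor_deriv_vec_mult_kron_power:
  assumes M: "M \<in> carrier_mat a (b ^ k)"
    and f: "\<And>y. y \<in> carrier_vec b \<Longrightarrow> f y = M *\<^sub>v kron_vec_power y k"
    and b: "0 < b" and r: "r \<le> k" and x: "x \<in> carrier_vec b"
  shows "tensor_deriv_vec r f x = ((M * Gamma_mat b k r) \<otimes>\<^sub>m symmetrizer b r) *\<^sub>v
    (kron_vec_power x (k - r) \<otimes>\<^sub>v vectorize (1\<^sub>m (b ^ r)))" (is "?L = ?R")
proof (rule eq_vec_blockI)
  let ?N = "M * Gamma_mat b k r"
  let ?S = "symmetrizer b r"
  have e: "b ^ (k - r) * b ^ r = b ^ k" using r by (simp add: power_add[symmetric])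
  have N: "?N \<in> carrier_mat a (b ^ (k - r) * b ^ r)"
    unfolding e by (rule mult_carrier_mat[OF M Gamma_mat_carrier[OF r]])
  note S = symmetrizer_carrier[OF b, of r]
  have dim: "dim_vec (f x) = a" using f[OF x] M by simp
  show "?L \<in> carrier_vec (a * b ^ r)" using x dim by (simp add: tensor_deriv_vec_def)
  show "?R \<in> carrier_vec (a * b ^ r)"
    using kron_mat_carrier[OF N S] kron_vec_carrier[OF kron_vec_power_carrier[OF x]
        vectorize_carrier[OF one_carrier_mat]]
    by (intro mult_mat_vec_carrier[of _ _ "b ^ (k - r) * b ^ r * b ^ r"]) (simp_all add: mult.assoc)
  fix l q assume l: "l < a" and q: "q < b ^ r"
  let ?g = "\<lambda>m. mixed_partial (multi_index b r m) (\<lambda>y. f y $ l) x"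
  have "?R $ (l * b ^ r + q) = (\<Sum>m<b ^ r. ?S $$ (q, m) * ?g m)"
    unfolding kron_mat_mult_kron_vectorize_one[OF N S kron_vec_power_carrier[OF x] l q]
    by (intro sum.cong refl) (simp only: mixed_partial_mult_kron_power[OF M f l b r x] lessThan_iff)
  also have "\<dots> = ?g q"
  proof (rule symmetrizer_fixes_symmetric[OF b q])
    fix m assume "mset (multi_index b r q) = mset (multi_index b r m)"
    thus "?g m = ?g q"
      using digit_less[OF b]
      by (intro mixed_partial_symmetric[OF mult_kron_power_polynomial[OF M f l]] x)
        (auto simp: multi_index_def)
  qed
  also have "\<dots> = ?L $ (l * b ^ r + q)"
  proof -
    have "(l * b ^ r + q) div b ^ r = l" "(l * b ^ r + q) mod b ^ r = q" using q b by simp_all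
    thus ?thesis
      using x dim q block_index_less[OF l q] by (simp add: tensor_deriv_vec_def tensor_deriv_def)
  qed
  finally show "?L $ (l * b ^ r + q) = ?R $ (l * b ^ r + q)" ..
qed

section \<open>Matrix powers\<close>

abbreviation (input) vec_one_row :: "nat \<Rightarrow> real mat" where
  "vec_one_row d \<equiv> mat_of_row (vectorize (1\<^sub>m d))"

lemma vec_one_row_carrier: "vec_one_row d \<in> carrier_mat 1 (d * d)"
  by (auto simp: mat_of_row_def vectorize_def)

lemma vec_one_row_index:
  "i < d \<Longrightarrow> j < d \<Longrightarrow> vec_one_row d $$ (0, i * d + j) = (if i = j then 1 else 0)"
  using vectorize_index[OF one_carrier_mat, of j d i] block_index_less[of i d j d]
    vectorize_carrier[OF one_carrier_mat[of d]]
  by (auto simp: mat_of_row_def)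

lemma vec_one_row_mult_vectorize:
  assumes A: "A \<in> carrier_mat d d"
  shows "vec_one_row d *\<^sub>v vectorize A = vec 1 (\<lambda>_. mat_trace A)"
proof (rule eq_vecI)
  have "(vec_one_row d *\<^sub>v vectorize A) $ 0 =
      (\<Sum>i<d. \<Sum>j<d. if i = j then A $$ (j, i) else 0)"
    unfolding mult_mat_vec_index_sum[OF vec_one_row_carrier vectorize_carrier[OF A]
        less_one[THEN iffD2, OF refl]]
      sum_block_index
    by (intro sum.cong refl) (simp add: vec_one_row_index vectorize_index[OF A])
  also have "\<dots> = mat_trace A" using A by (simp add: mat_trace_def)
  finally show "(vec_one_row d *\<^sub>v vectorize A) $ i = vec 1 (\<lambda>_. mat_trace A) $ i"
    if "i < dim_vec (vec 1 (\<lambda>_. mat_trace A))" for i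
    using that by simp
qed (simp add: mat_of_row_def)

text \<open>
  The vector \<open>vec B \<otimes> vec A\<close> has the indices column of \<open>B\<close>, row of \<open>B\<close>, column of \<open>A\<close>, row of \<open>A\<close>.
  Multiplication by \<open>vec\<^sup>T I\<close> in the middle equates the row of \<open>B\<close> with the column of \<open>A\<close> and sums, which
  is the product \<open>A B\<close>, in this order because \<open>vec\<close> puts columns first.
\<close>

lemma contract_vectorize_kron:
  assumes A: "A \<in> carrier_mat d d" and B: "B \<in> carrier_mat d d"
  shows "(1\<^sub>m d \<otimes>\<^sub>m vec_one_row d \<otimes>\<^sub>m 1\<^sub>m d) *\<^sub>v (vectorize B \<otimes>\<^sub>v vectorize A) = vectorize (A * B)"
proof (rule eq_vec_blockI[of _ d d])
  let ?C = "1\<^sub>m d \<otimes>\<^sub>m vec_one_row d \<otimes>\<^sub>m 1\<^sub>m d"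
  note AB = mult_carrier_mat[OF A B]
  note IR = kron_mat_carrier[OF one_carrier_mat[of d] vec_one_row_carrier[of d]]
  have IR': "1\<^sub>m d \<otimes>\<^sub>m vec_one_row d \<in> carrier_mat d (d * (d * d))" using IR by simp
  have C: "?C \<in> carrier_mat (d * d) (d * (d * d) * d)"
    by (rule kron_mat_carrier[OF IR' one_carrier_mat])
  note k = kron_vec_carrier[OF vectorize_carrier[OF B] vectorize_carrier[OF A]]
  have v: "vectorize B \<otimes>\<^sub>v vectorize A \<in> carrier_vec (d * (d * d) * d)"
    using k by (simp add: mult.assoc)
  show "?C *\<^sub>v (vectorize B \<otimes>\<^sub>v vectorize A) \<in> carrier_vec (d * d)"
    by (rule mult_mat_vec_carrier[OF C v])
  show "vectorize (A * B) \<in> carrier_vec (d * d)" by (rule vectorize_carrier[OF AB])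
  fix j i assume j: "j < d" and i: "i < d"
  have row: "?C $$ (j * d + i, (j' * (d * d) + (s * d + t)) * d + i') =
      (if j' = j then 1 else 0) * (if s = t then 1 else 0) * (if i' = i then 1 else 0)"
    if "j' < d" "s < d" "t < d" "i' < d" for j' s t i'
  proof -
    note st = block_index_less[OF that(2,3)]
    note jst = block_index_less[OF that(1) st]
    have "(1\<^sub>m d \<otimes>\<^sub>m vec_one_row d) $$ (j, j' * (d * d) + (s * d + t)) =
        (if j' = j then 1 else 0) * (if s = t then 1 else 0)"
      using kron_mat_index[OF one_carrier_mat vec_one_row_carrier j
          less_one[THEN iffD2, OF refl] that(1) st]
        vec_one_row_index[OF that(2,3)] j that by auto
    thus ?thesis
      using kron_mat_index[OF IR' one_carrier_mat j i jst that(4)] i that by auto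
  qed
  have col: "(vectorize B \<otimes>\<^sub>v vectorize A) $ ((j' * (d * d) + (s * d + t)) * d + i') =
      B $$ (s, j') * A $$ (i', t)"
    if "j' < d" "s < d" "t < d" "i' < d" for j' s t i'
  proof -
    \<comment> \<open>The same position, grouped for \<open>?C\<close> on the left and for \<open>vec B \<otimes> vec A\<close> on the right.\<close>
    have pos: "(j' * (d * d) + (s * d + t)) * d + i' = (j' * d + s) * (d * d) + (t * d + i')"
      by (simp add: algebra_simps)
    show ?thesis
      unfolding pos
      using kron_vec_index[OF vectorize_carrier[OF B] vectorize_carrier[OF A]
          block_index_less[OF that(1,2)] block_index_less[OF that(3,4)]]
        vectorize_index[OF B that(2,1)] vectorize_index[OF A that(4,3)] by simp
  qed
  have "(?C *\<^sub>v (vectorize B \<otimes>\<^sub>v vectorize A)) $ (j * d + i) =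
      (\<Sum>j'<d. \<Sum>s<d. \<Sum>t<d. \<Sum>i'<d. (if j' = j then 1 else 0) * (if s = t then 1 else 0) *
        (if i' = i then 1 else 0) * (B $$ (s, j') * A $$ (i', t)))"
    unfolding mult_mat_vec_index_sum[OF C v block_index_less[OF j i]] sum_block_index
    by (intro sum.cong refl) (simp only: row col lessThan_iff)
  also have "\<dots> = (\<Sum>j'<d. (if j' = j then 1 else 0) * (\<Sum>s<d. \<Sum>t<d. (if s = t then 1 else 0) *
      (\<Sum>i'<d. (if i' = i then 1 else 0) * (B $$ (s, j') * A $$ (i', t)))))"
    by (simp only: sum_distrib_left mult.assoc)
  also have "\<dots> = (\<Sum>s<d. A $$ (i, s) * B $$ (s, j))"
    using i j by (simp add: if_distrib[of "\<lambda>x. x * _"] mult.commute cong: if_cong)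
  also have "\<dots> = vectorize (A * B) $ (j * d + i)"
    unfolding vectorize_index[OF AB i j] mult_mat_index_sum[OF A B i j] ..
  finally show "(?C *\<^sub>v (vectorize B \<otimes>\<^sub>v vectorize A)) $ (j * d + i) =
      vectorize (A * B) $ (j * d + i)" .
qed

text \<open>
  The factor in front of \<open>\<Gamma>\<close> in \<open>\<Upsilon>\<close>; \<open>m\<close> counts the contracted index pairs, one less than the number of
  factors of the matrix power.
\<close>

definition contraction :: "nat \<Rightarrow> nat \<Rightarrow> real mat" where
  "contraction d m = 1\<^sub>m d \<otimes>\<^sub>m kron_mat_power (vec_one_row d) m \<otimes>\<^sub>m 1\<^sub>m d"

lemma contraction_carrier: "contraction d m \<in> carrier_mat (d * d) ((d * d) ^ Suc m)"
proof -
  have "contraction d m \<in> carrier_mat (d * 1 ^ m * d) (d * (d * d) ^ m * d)"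
    unfolding contraction_def
    by (intro kron_mat_carrier kron_mat_power_carrier vec_one_row_carrier one_carrier_mat)
  thus ?thesis by (simp add: algebra_simps)
qed

text \<open>
  All neighbouring pairs but the first are contracted, and then the first: the row vectors in the two
  matrices act on disjoint groups of indices, so the mixed product rule merges them.
\<close>

lemma contraction_Suc:
  "contraction d (Suc m) = (1\<^sub>m d \<otimes>\<^sub>m vec_one_row d \<otimes>\<^sub>m 1\<^sub>m d) * (1\<^sub>m (d * d) \<otimes>\<^sub>m contraction d m)"
proof -
  let ?R = "vec_one_row d"
  let ?P = "kron_mat_power ?R m"
  have P: "?P \<in> carrier_mat 1 ((d * d) ^ m)"
    using kron_mat_power_carrier[OF vec_one_row_carrier, of d m] by simp
  have PI: "?P \<otimes>\<^sub>m 1\<^sub>m d \<in> carrier_mat d ((d * d) ^ m * d)"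
    using kron_mat_carrier[OF P one_carrier_mat[of d]] by simp
  have IPI: "1\<^sub>m (d * d) \<otimes>\<^sub>m (?P \<otimes>\<^sub>m 1\<^sub>m d) \<in> carrier_mat (d * d * d) (d * d * ((d * d) ^ m * d))"
    by (rule kron_mat_carrier[OF one_carrier_mat PI])
  have RI: "?R \<otimes>\<^sub>m 1\<^sub>m d \<in> carrier_mat d (d * d * d)"
    using kron_mat_carrier[OF vec_one_row_carrier[of d] one_carrier_mat[of d]] by simp
  have e: "1\<^sub>m (d * d) \<otimes>\<^sub>m contraction d m = 1\<^sub>m d \<otimes>\<^sub>m (1\<^sub>m (d * d) \<otimes>\<^sub>m (?P \<otimes>\<^sub>m 1\<^sub>m d))"
    unfolding contraction_def kron_mat_assoc[symmetric] kron_mat_one_one by (simp add: mult.assoc)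
  have "(1\<^sub>m d \<otimes>\<^sub>m ?R \<otimes>\<^sub>m 1\<^sub>m d) * (1\<^sub>m (d * d) \<otimes>\<^sub>m contraction d m) =
      (1\<^sub>m d \<otimes>\<^sub>m (?R \<otimes>\<^sub>m 1\<^sub>m d)) * (1\<^sub>m d \<otimes>\<^sub>m (1\<^sub>m (d * d) \<otimes>\<^sub>m (?P \<otimes>\<^sub>m 1\<^sub>m d)))"
    unfolding e kron_mat_assoc ..
  also have "\<dots> = 1\<^sub>m d \<otimes>\<^sub>m ((?R \<otimes>\<^sub>m 1\<^sub>m d) * (1\<^sub>m (d * d) \<otimes>\<^sub>m (?P \<otimes>\<^sub>m 1\<^sub>m d)))"
    using kron_mat_mult[OF one_carrier_mat RI one_carrier_mat IPI] by simp
  also have "(?R \<otimes>\<^sub>m 1\<^sub>m d) * (1\<^sub>m (d * d) \<otimes>\<^sub>m (?P \<otimes>\<^sub>m 1\<^sub>m d)) = ?R \<otimes>\<^sub>m (?P \<otimes>\<^sub>m 1\<^sub>m d)"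
    using kron_mat_mult[OF vec_one_row_carrier one_carrier_mat one_carrier_mat PI]
      right_mult_one_mat[OF vec_one_row_carrier[of d]] left_mult_one_mat[OF PI] by simp
  also have "1\<^sub>m d \<otimes>\<^sub>m \<dots> = contraction d (Suc m)"
    by (simp add: contraction_def kron_mat_assoc)
  finally show ?thesis ..
qed

lemma contraction_kron_power:
  assumes X: "X \<in> carrier_mat d d"
  shows "contraction d m *\<^sub>v kron_vec_power (vectorize X) (Suc m) = vectorize (X ^\<^sub>m Suc m)"
proof (induction m)
  case 0
  show ?case
    using vectorize_carrier[OF X] X
    by (simp add: contraction_def kron_mat_one_right[unfolded One_nat_def] kron_mat_one_one
        kron_vec_power_one)
next
  case (Suc m)
  let ?v = "kron_vec_power (vectorize X) (Suc m)"
  let ?C = "1\<^sub>m d \<otimes>\<^sub>m vec_one_row d \<otimes>\<^sub>m 1\<^sub>m d"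
  note vX = vectorize_carrier[OF X]
  note v = kron_vec_power_carrier[OF vX, of "Suc m"]
  note Xm = pow_carrier_mat[OF X, of "Suc m"]
  have IC: "1\<^sub>m (d * d) \<otimes>\<^sub>m contraction d m \<in> carrier_mat (d * d * (d * d)) (d * d * (d * d) ^ Suc m)"
    by (rule kron_mat_carrier[OF one_carrier_mat contraction_carrier])
  have C: "?C \<in> carrier_mat (d * d) (d * d * (d * d))"
    using kron_mat_carrier[OF kron_mat_carrier[OF one_carrier_mat[of d] vec_one_row_carrier[of d]]
        one_carrier_mat[of d]] by (simp add: mult.assoc)
  have "contraction d (Suc m) *\<^sub>v kron_vec_power (vectorize X) (Suc (Suc m)) =
      ?C *\<^sub>v ((1\<^sub>m (d * d) \<otimes>\<^sub>m contraction d m) *\<^sub>v (vectorize X \<otimes>\<^sub>v ?v))"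
    unfolding contraction_Suc kron_vec_power_Suc[of _ "Suc m"]
    by (rule assoc_mult_mat_vec[OF C IC kron_vec_carrier[OF vX v]])
  also have "\<dots> = ?C *\<^sub>v (vectorize X \<otimes>\<^sub>v vectorize (X ^\<^sub>m Suc m))"
    using kron_mat_mult_vec[OF one_carrier_mat contraction_carrier vX v] Suc.IH vX by simp
  also have "\<dots> = vectorize (X ^\<^sub>m Suc (Suc m))"
    using contract_vectorize_kron[OF Xm X] by simp
  finally show ?case .
qed

lemma tensor_deriv_vec_scalar:
  assumes "x \<in> carrier_vec d"
  shows "tensor_deriv_vec r (\<lambda>y. vec 1 (\<lambda>_. f y)) x = tensor_deriv r f x"
  using assms by (intro eq_vecI) (auto simp: tensor_deriv_vec_def tensor_deriv_def)

theorem theorem7: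
  fixes r k c d :: nat
  assumes "1 \<le> r" and "r \<le> k" and "0 < c" and "0 < d"
  shows
    "(has_partials_vec (c * d) ((c * d) ^ k) r
        (of_vectorized c d (\<lambda>X. kron_vec_power (vectorize X) k)) \<and>
      (\<forall>X \<in> carrier_mat c d.
        tensor_deriv_vec r (of_vectorized c d (\<lambda>X. kron_vec_power (vectorize X) k)) (vectorize X) =
          (Gamma_mat (c * d) k r \<otimes>\<^sub>m symmetrizer (c * d) r) *\<^sub>v
          (kron_vec_power (vectorize X) (k - r) \<otimes>\<^sub>v vectorize (1\<^sub>m ((c * d) ^ r))) \<and>
        tensor_deriv_vec r (of_vectorized c d (\<lambda>X. kron_vec_power (vectorize X) k)) (vectorize X)
          \<in> carrier_vec ((c * d) ^ (k + r)))) \<and>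
     (has_partials_vec d (d ^ k) r (\<lambda>x. kron_vec_power x k) \<and>
      (\<forall>x \<in> carrier_vec d.
        tensor_deriv_vec r (\<lambda>x. kron_vec_power x k) x =
          (Gamma_mat d k r \<otimes>\<^sub>m symmetrizer d r) *\<^sub>v
          (kron_vec_power x (k - r) \<otimes>\<^sub>v vectorize (1\<^sub>m (d ^ r))) \<and>
        tensor_deriv_vec r (\<lambda>x. kron_vec_power x k) x \<in> carrier_vec (d ^ (k + r)))) \<and>
     (has_partials_vec (d * d) (d * d) r (of_vectorized d d (\<lambda>X. vectorize (X ^\<^sub>m k))) \<and>
      (\<forall>X \<in> carrier_mat d d.
        tensor_deriv_vec r (of_vectorized d d (\<lambda>X. vectorize (X ^\<^sub>m k))) (vectorize X) =
          (Upsilon_mat d k r \<otimes>\<^sub>m symmetrizer (d ^ 2) r) *\<^sub>v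
          (kron_vec_power (vectorize X) (k - r) \<otimes>\<^sub>v vectorize (1\<^sub>m (d ^ (2 * r)))) \<and>
        tensor_deriv_vec r (of_vectorized d d (\<lambda>X. vectorize (X ^\<^sub>m k))) (vectorize X)
          \<in> carrier_vec (d ^ (2 * r + 2)))) \<and>
     (has_partials (d * d) r (of_vectorized d d (\<lambda>X. mat_trace (X ^\<^sub>m k))) \<and>
      (\<forall>X \<in> carrier_mat d d.
        tensor_deriv r (of_vectorized d d (\<lambda>X. mat_trace (X ^\<^sub>m k))) (vectorize X) =
          ((mat_of_row (vectorize (1\<^sub>m d)) * Upsilon_mat d k r) \<otimes>\<^sub>m symmetrizer (d ^ 2) r) *\<^sub>v
          (kron_vec_power (vectorize X) (k - r) \<otimes>\<^sub>v vectorize (1\<^sub>m (d ^ (2 * r)))) \<and>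
        tensor_deriv r (of_vectorized d d (\<lambda>X. mat_trace (X ^\<^sub>m k))) (vectorize X)
          \<in> carrier_vec (d ^ (2 * r))))"
proof -
  let ?kron = "\<lambda>x. kron_vec_power x k"
  let ?pow = "of_vectorized d d (\<lambda>X. vectorize (X ^\<^sub>m k))"
  let ?tr = "of_vectorized d d (\<lambda>X. mat_trace (X ^\<^sub>m k))"
  let ?R = "vec_one_row d"
  let ?C = "contraction d (k - 1)"
  obtain m where k: "k = Suc m" using assms by (cases k) auto
  note rk = assms(2)
  have cd: "0 < c * d" and dd: "0 < d * d" using assms by simp_all
  have unvec: "unvectorize p q v \<in> carrier_mat p q" for p q v by (simp add: unvectorize_def)

  have kron: "has_partials_vec b (b ^ k) r f"
    "x \<in> carrier_vec b \<Longrightarrow> tensor_deriv_vec r f x = (Gamma_mat b k r \<otimes>\<^sub>m symmetrizer b r) *\<^sub>v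
      (kron_vec_power x (k - r) \<otimes>\<^sub>v vectorize (1\<^sub>m (b ^ r)))"
    "x \<in> carrier_vec b \<Longrightarrow> tensor_deriv_vec r f x \<in> carrier_vec (b ^ (k + r))"
    if b: "0 < b" and f: "\<And>y. y \<in> carrier_vec b \<Longrightarrow> f y = kron_vec_power y k" for b f x
  proof -
    have f1: "f y = 1\<^sub>m (b ^ k) *\<^sub>v kron_vec_power y k" if "y \<in> carrier_vec b" for y
      using f[OF that] kron_vec_power_carrier[OF that, of k] by simp
    show "has_partials_vec b (b ^ k) r f"
      by (rule mult_kron_power_has_partials_vec[OF one_carrier_mat f1])
    show "tensor_deriv_vec r f x \<in> carrier_vec (b ^ (k + r))" if x: "x \<in> carrier_vec b"
      using x f[OF x] kron_vec_power_carrier[OF x, of k] by (simp add: tensor_deriv_vec_def power_add)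
    show "tensor_deriv_vec r f x = (Gamma_mat b k r \<otimes>\<^sub>m symmetrizer b r) *\<^sub>v
      (kron_vec_power x (k - r) \<otimes>\<^sub>v vectorize (1\<^sub>m (b ^ r)))" if x: "x \<in> carrier_vec b"
      using tensor_deriv_vec_mult_kron_power[OF one_carrier_mat f1 b rk x]
        Gamma_mat_carrier[OF rk, of b] by simp
  qed

  have pow: "?pow v = ?C *\<^sub>v kron_vec_power v k" if v: "v \<in> carrier_vec (d * d)" for v
    using contraction_kron_power[OF unvec[of d d v], of m] vectorize_unvectorize[OF v]
    by (simp add: of_vectorized_def k)
  have C: "?C \<in> carrier_mat (d * d) ((d * d) ^ k)"
    using contraction_carrier[of d m] by (simp add: k)
  have RC: "?R * ?C \<in> carrier_mat 1 ((d * d) ^ k)"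
    by (rule mult_carrier_mat[OF vec_one_row_carrier C])
  \<comment> \<open>The trace enters the general lemma as a function with values in \<open>\<real>\<^sup>1\<close>.\<close>
  have tr: "vec 1 (\<lambda>_. ?tr v) = (?R * ?C) *\<^sub>v kron_vec_power v k"
    if v: "v \<in> carrier_vec (d * d)" for v
  proof -
    have "(?R * ?C) *\<^sub>v kron_vec_power v k = ?R *\<^sub>v ?pow v"
      using assoc_mult_mat_vec[OF vec_one_row_carrier C kron_vec_power_carrier[OF v]] pow[OF v] by simp
    thus ?thesis
      using vec_one_row_mult_vectorize[OF pow_carrier_mat[OF unvec[of d d v], of k]]
      by (simp add: of_vectorized_def)
  qed
  have U: "?C * Gamma_mat (d * d) k r = Upsilon_mat d k r"
    by (simp add: contraction_def Upsilon_mat_def power2_eq_square)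
  have RU: "(?R * ?C) * Gamma_mat (d * d) k r = ?R * Upsilon_mat d k r"
    using assoc_mult_mat[OF vec_one_row_carrier C Gamma_mat_carrier[OF rk]] U by simp
  have e: "(d * d) ^ r = d ^ (2 * r)" "(d ^ 2) ^ r = d ^ (2 * r)" "d * d = d ^ 2"
    by (simp_all add: power_mult power2_eq_square)

  have "has_partials_vec (d * d) (d * d) r ?pow"
    by (rule mult_kron_power_has_partials_vec[OF C pow])
  moreover have "tensor_deriv_vec r ?pow (vectorize X) =
      (Upsilon_mat d k r \<otimes>\<^sub>m symmetrizer (d ^ 2) r) *\<^sub>v
      (kron_vec_power (vectorize X) (k - r) \<otimes>\<^sub>v vectorize (1\<^sub>m (d ^ (2 * r))))"
    if "X \<in> carrier_mat d d" for X
    using tensor_deriv_vec_mult_kron_power[OF C pow dd rk vectorize_carrier[OF that]]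
    unfolding U by (simp only: e(2,3))
  moreover have "tensor_deriv_vec r ?pow (vectorize X) \<in> carrier_vec (d ^ (2 * r + 2))"
    if X: "X \<in> carrier_mat d d" for X
  proof -
    have "d * d * (d * d) ^ r = d ^ (2 * r + 2)"
      by (simp add: e(1) power_add power2_eq_square)
    moreover have "dim_vec (?pow (vectorize X)) = d * d"
      using pow[OF vectorize_carrier[OF X]] C by simp
    ultimately show ?thesis
      using vectorize_carrier[OF X] by (simp add: tensor_deriv_vec_def)
  qed
  moreover have "has_partials (d * d) r ?tr"
    using mult_kron_power_has_partials_vec[OF RC tr] by (simp add: has_partials_vec_def)
  moreover have "tensor_deriv r ?tr (vectorize X) =
      ((?R * Upsilon_mat d k r) \<otimes>\<^sub>m symmetrizer (d ^ 2) r) *\<^sub>v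
      (kron_vec_power (vectorize X) (k - r) \<otimes>\<^sub>v vectorize (1\<^sub>m (d ^ (2 * r))))"
    if "X \<in> carrier_mat d d" for X
    using tensor_deriv_vec_mult_kron_power[OF RC tr dd rk vectorize_carrier[OF that]]
    unfolding RU tensor_deriv_vec_scalar[OF vectorize_carrier[OF that]] by (simp only: e(2,3))
  moreover have "tensor_deriv r ?tr (vectorize X) \<in> carrier_vec (d ^ (2 * r))"
    if "X \<in> carrier_mat d d" for X
    using vectorize_carrier[OF that] by (simp add: tensor_deriv_def e(1)[symmetric])
  moreover have "of_vectorized c d (\<lambda>X. ?kron (vectorize X)) v = ?kron v"
    if "v \<in> carrier_vec (c * d)" for v
    using vectorize_unvectorize[OF that] by (simp add: of_vectorized_def)
  note kron_mat = kron[of "c * d" "of_vectorized c d (\<lambda>X. ?kron (vectorize X))", OF cd this]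
  ultimately show ?thesis
    using kron_mat kron[OF assms(4), of ?kron] vectorize_carrier by blast
qed

end
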